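(* The following two decision problems are undecidable. (1) Given two CRPQs $Q_1$ and $Q_2$ over a common finite alphabet, decide whether $Q_1\subseteq_{a\text{-}inj}Q_2$, that is, whether $Q_1(G)^{a\text{-}inj}\subseteq Q_2(G)^{a\text{-}inj}$ for every graph database $G$. (2) The same problem restricted to inputs in which $Q_1$ is an arbitrary CRPQ and $Q_2$ is a CRPQ in $\mathsf{CRPQ}^{\mathsf{fin}}$, i.e. all of whose regular expressions contain no Kleene star.
   Context: A graph database over a finite alphabet $\mathbb{A}$ is a finite edge-labeled directed graph $G=(V,E)$ with $E\subseteq V\times\mathbb{A}\times V$. A path from $u$ to $v$ is a sequence of edges $v_0\xrightarrow{a_1}v_1,\dots,v_{k-1}\xrightarrow{a_k}v_k$ of $G$ with $k\ge 0$, $u=v_0$, $v=v_k$; its label is $a_1\cdots a_k$. It is a simple path if all $v_i$ are pairwise distinct, and a simple cycle if $v_0=v_k$ and $v_0,\dots,v_{k-1}$ are pairwise distinct. A conjunctive regular path query (CRPQ) over $\mathbb{A}$ is an expression $Q(\bar z)=A_1\wedge\dots\wedge A_m$ ($m\ge 0$), where each atom $A_i$ has the form $x_i\xrightarrow{L_i}y_i$ with $x_i,y_i$ variables (possibly equal) and $L_i$ a regular expression over $\mathbb{A}$, and $\bar z$ is a tuple of (not necessarily distinct) free variables; $\mathrm{vars}(Q)$ is its set of variables (including the free ones). $\mathsf{CRPQ}^{\mathsf{fin}}$ is the class of CRPQs whose regular expressions have no Kleene star (neither $^*$ nor $^+$ iteration), hence denote finite languages. Atom-injective semantics. If no $L_i$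 contains the empty word $\epsilon$, then $Q(G)^{a\text{-}inj}$ is the set of tuples $\bar v$ for which there is a map $\mu:\mathrm{vars}(Q)\to V$ with $\mu(\bar z)=\bar v$ and, for each $i$, a path $\pi_i$ from $\mu(x_i)$ to $\mu(y_i)$ in $G$ with label in $L_i$, which is a simple path if $x_i\ne y_i$ and a simple cycle if $x_i=y_i$. If $Q(\bar z)=x\xrightarrow{L}y\wedge Q'$ with $\epsilon\in L$, then $Q(G)^{a\text{-}inj}$ is (recursively) the union of the evaluation of $x\xrightarrow{L\setminus\{\epsilon\}}y\wedge Q'$ with free tuple $\bar z$ and the evaluation of $Q'[x/y]$ with free tuple $\bar z[x/y]$, where $[x/y]$ replaces every occurrence of $x$ by $y$; the variable $y$ is kept as a variable of the resulting query even if it no longer occurs in any atom. *)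

theory Defs
  imports Main "HOL-Library.Nat_Bijection"
begin

section \<open>Regular expressions\<close>

text \<open>Letters are natural numbers. The iteration \<open>r\<^sup>+\<close> is \<open>Times r (Star r)\<close>.\<close>

datatype rexp =
    Empty
  | Eps
  | Letter nat
  | Alt rexp rexp
  | Times rexp rexp
  | Star rexp

fun lang :: "rexp \<Rightarrow> nat list set" where
  "lang Empty = {}"
| "lang Eps = {[]}"
| "lang (Letter a) = {[a]}"
| "lang (Alt r s) = lang r \<union> lang s"
| "lang (Times r s) = {u @ v | u v. u \<in> lang r \<and> v \<in> lang s}"
| "lang (Star r) = {concat ws | ws. set ws \<subseteq> lang r}"

fun letters :: "rexp \<Rightarrow> nat set" where
  "letters Empty = {}"
| "letters Eps = {}"
| "letters (Letter a) = {a}"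
| "letters (Alt r s) = letters r \<union> letters s"
| "letters (Times r s) = letters r \<union> letters s"
| "letters (Star r) = letters r"

fun starless :: "rexp \<Rightarrow> bool" where
  "starless Empty = True"
| "starless Eps = True"
| "starless (Letter a) = True"
| "starless (Alt r s) = (starless r \<and> starless s)"
| "starless (Times r s) = (starless r \<and> starless s)"
| "starless (Star r) = False"


section \<open>Graph databases and paths\<close>

type_synonym 'v graph = "'v set \<times> ('v \<times> nat \<times> 'v) set"

definition graph_db :: "nat set \<Rightarrow> 'v graph \<Rightarrow> bool" where
  "graph_db A G \<longleftrightarrow> finite A \<and> finite (fst G) \<and> snd G \<subseteq> fst G \<times> A \<times> fst G"

text \<open>A path is given by its vertex sequence \<open>vs = [v\<^sub>0, \<dots>, v\<^sub>k]\<close> and its label \<open>w\<close>, of length \<open>k\<close>.\<close>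

definition is_path :: "'v graph \<Rightarrow> 'v \<Rightarrow> 'v list \<Rightarrow> nat list \<Rightarrow> 'v \<Rightarrow> bool" where
  "is_path G u vs w v \<longleftrightarrow>
     length vs = Suc (length w) \<and> set vs \<subseteq> fst G \<and> hd vs = u \<and> last vs = v \<and>
     (\<forall>i < length w. (vs ! i, w ! i, vs ! Suc i) \<in> snd G)"

definition simple_path :: "'v graph \<Rightarrow> 'v \<Rightarrow> 'v list \<Rightarrow> nat list \<Rightarrow> 'v \<Rightarrow> bool" where
  "simple_path G u vs w v \<longleftrightarrow> is_path G u vs w v \<and> distinct vs"

definition simple_cycle :: "'v graph \<Rightarrow> 'v \<Rightarrow> 'v list \<Rightarrow> nat list \<Rightarrow> 'v \<Rightarrow> bool" where
  "simple_cycle G u vs w v \<longleftrightarrow> is_path G u vs w v \<and> u = v \<and> distinct (butlast vs)"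


section \<open>Conjunctive regular path queries\<close>

datatype crpq = CRPQ (atoms: "(nat \<times> rexp \<times> nat) list") (free: "nat list")

definition vars :: "crpq \<Rightarrow> nat set" where
  "vars Q = (\<Union>(x, r, y) \<in> set (atoms Q). {x, y}) \<union> set (free Q)"

definition crpq_over :: "nat set \<Rightarrow> crpq \<Rightarrow> bool" where
  "crpq_over A Q \<longleftrightarrow> (\<forall>(x, r, y) \<in> set (atoms Q). letters r \<subseteq> A)"

definition crpq_fin :: "crpq \<Rightarrow> bool" where
  "crpq_fin Q \<longleftrightarrow> (\<forall>(x, r, y) \<in> set (atoms Q). starless r)"


section \<open>Atom-injective semantics\<close>

text \<open>The recursive elimination of the empty word leaves the syntax of queries: it replaces
  languages \<open>L\<close> by \<open>L - {[]}\<close> and may keep variables that no longer occur in an atom. The semantics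
  is therefore defined for triples of a variable set \<open>X\<close>, a list of atoms labelled by languages, and
  a free tuple \<open>zs\<close>.\<close>

type_synonym latom = "nat \<times> nat list set \<times> nat"

definition subst :: "nat \<Rightarrow> nat \<Rightarrow> nat \<Rightarrow> nat" where
  "subst x y v = (if v = x then y else v)"

definition subst_atom :: "nat \<Rightarrow> nat \<Rightarrow> latom \<Rightarrow> latom" where
  "subst_atom x y = (\<lambda>(u, L, v). (subst x y u, L, subst x y v))"

definition sat_atom :: "'v graph \<Rightarrow> (nat \<Rightarrow> 'v) \<Rightarrow> latom \<Rightarrow> bool" where
  "sat_atom G \<mu> = (\<lambda>(x, L, y). \<exists>vs. \<exists>w \<in> L.
     if x = y then simple_cycle G (\<mu> x) vs w (\<mu> y) else simple_path G (\<mu> x) vs w (\<mu> y))"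

text \<open>In the rules \<open>keep\<close> and \<open>merge\<close> the atom containing the empty word may be any atom of the
  query.\<close>

inductive ainj_ans :: "'v graph \<Rightarrow> nat set \<Rightarrow> latom list \<Rightarrow> nat list \<Rightarrow> 'v list \<Rightarrow> bool"
  for G :: "'v graph" where
  base: "\<lbrakk>\<forall>(x, L, y) \<in> set As. [] \<notin> L; \<mu> ` X \<subseteq> fst G; \<forall>a \<in> set As. sat_atom G \<mu> a\<rbrakk>
    \<Longrightarrow> ainj_ans G X As zs (map \<mu> zs)"
| keep: "\<lbrakk>[] \<in> L; ainj_ans G X (As @ (x, L - {[]}, y) # Bs) zs t\<rbrakk>
    \<Longrightarrow> ainj_ans G X (As @ (x, L, y) # Bs) zs t"
| merge: "\<lbrakk>[] \<in> L;
      ainj_ans G (subst x y ` X) (map (subst_atom x y) (As @ Bs)) (map (subst x y) zs) t\<rbrakk>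
    \<Longrightarrow> ainj_ans G X (As @ (x, L, y) # Bs) zs t"

definition ainj :: "crpq \<Rightarrow> 'v graph \<Rightarrow> 'v list set" where
  "ainj Q G = {t. ainj_ans G (vars Q) (map (\<lambda>(x, r, y). (x, lang r, y)) (atoms Q)) (free Q) t}"

text \<open>Graph databases are finite, so up to isomorphism their vertices are natural numbers.\<close>

definition ainj_contained :: "nat set \<Rightarrow> crpq \<Rightarrow> crpq \<Rightarrow> bool" where
  "ainj_contained A Q1 Q2 \<longleftrightarrow> (\<forall>G :: nat graph. graph_db A G \<longrightarrow> ainj Q1 G \<subseteq> ainj Q2 G)"


section \<open>Partial recursive functions and decidability\<close>

text \<open>Primitive recursion is on the first argument, and minimisation searches for the first
  argument; \<open>None\<close> means that the computation diverges or that an argument is missing.\<close>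

datatype recf =
    Zero
  | Succ
  | Proj nat
  | Comp recf "recf list"
  | PrimRec recf recf
  | Mu recf

fun reval :: "recf \<Rightarrow> nat list \<Rightarrow> nat option" where
  "reval Zero xs = Some 0"
| "reval Succ xs = (case xs of [] \<Rightarrow> None | x # _ \<Rightarrow> Some (Suc x))"
| "reval (Proj i) xs = (if i < length xs then Some (xs ! i) else None)"
| "reval (Comp f gs) xs =
     (case those (map (\<lambda>g. reval g xs) gs) of None \<Rightarrow> None | Some ys \<Rightarrow> reval f ys)"
| "reval (PrimRec f g) xs =
     (case xs of
        [] \<Rightarrow> None
      | n # ys \<Rightarrow>
          rec_nat (reval f ys)
            (\<lambda>m r. case r of None \<Rightarrow> None | Some y \<Rightarrow> reval g (m # y # ys)) n)"
| "reval (Mu f) xs =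
     (if \<exists>n. reval f (n # xs) = Some 0 \<and> (\<forall>m < n. \<exists>k. reval f (m # xs) = Some k)
      then Some (LEAST n. reval f (n # xs) = Some 0) else None)"

text \<open>\<open>decidable_on D code P\<close>: some partial recursive function decides \<open>P\<close> on all inputs from \<open>D\<close>,
  given by their codes. Its behaviour on numbers that do not code an input from \<open>D\<close> is irrelevant.\<close>

definition decidable_on :: "'a set \<Rightarrow> ('a \<Rightarrow> nat) \<Rightarrow> ('a \<Rightarrow> bool) \<Rightarrow> bool" where
  "decidable_on D code P \<longleftrightarrow>
     (\<exists>f. \<forall>i \<in> D. reval f [code i] = Some (if P i then 1 else 0))"


section \<open>The containment problem\<close>

fun rexp_code :: "rexp \<Rightarrow> nat" where
  "rexp_code Empty = prod_encode (0, 0)"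
| "rexp_code Eps = prod_encode (1, 0)"
| "rexp_code (Letter a) = prod_encode (2, a)"
| "rexp_code (Alt r s) = prod_encode (3, prod_encode (rexp_code r, rexp_code s))"
| "rexp_code (Times r s) = prod_encode (4, prod_encode (rexp_code r, rexp_code s))"
| "rexp_code (Star r) = prod_encode (5, rexp_code r)"

definition atom_code :: "nat \<times> rexp \<times> nat \<Rightarrow> nat" where
  "atom_code = (\<lambda>(x, r, y). prod_encode (x, prod_encode (rexp_code r, y)))"

definition crpq_code :: "crpq \<Rightarrow> nat" where
  "crpq_code Q = prod_encode (list_encode (map atom_code (atoms Q)), list_encode (free Q))"

text \<open>An input \<open>(n, Q1, Q2)\<close> consists of two queries over the common alphabet \<open>{..<n}\<close>.\<close>

type_synonym containment_input = "nat \<times> crpq \<times> crpq"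

definition input_code :: "containment_input \<Rightarrow> nat" where
  "input_code = (\<lambda>(n, Q1, Q2). prod_encode (n, prod_encode (crpq_code Q1, crpq_code Q2)))"

definition containment_inputs :: "containment_input set" where
  "containment_inputs = {(n, Q1, Q2). crpq_over {..<n} Q1 \<and> crpq_over {..<n} Q2}"

definition containment_holds :: "containment_input \<Rightarrow> bool" where
  "containment_holds = (\<lambda>(n, Q1, Q2). ainj_contained {..<n} Q1 Q2)"

end

theory Submission
  imports Defs "HOL-Library.Countable" "HOL-Library.Sublist"
begin

text \<open>
A program over integer counters is a regular expression over the instructions \<open>Inc r\<close>, \<open>Dec r\<close>
and the zero test \<open>Tst r\<close>; it halts iff some word of its language can be executed. Every partial
recursive function is computed by such a program. For each counter \<open>r\<close>, write every instruction
as a unit event, except that \<open>Inc r\<close> counts twice on the first side, \<open>Dec r\<close> counts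
twice on the second side, and \<open>Tst r\<close> is a mark on both. A word is executable iff for each
\<open>r\<close> its two event words are comparable by prefix, that is, iff both fit one common event word.

The first query provides a path labelled by a word of the program, one event path per counter, and
for each counter and side a zigzag between these two paths. The second query is a single atom with a
finite language of bad words. It has no match iff every bad walk of the database repeats a
vertex, and the bad words are chosen such that these repetitions identify the vertices of the zigzags
with the vertices of the two paths, from left to right. Hence containment fails iff the program halts.

No universal machine is needed for the diagonal argument: a program receives the codes of its own
queries as initial counter values, and the reduction only has to prepend these increments.
\<close>

section \<open>Counter programs as regular expressions over instructions\<close>

text \<open>Atom-injectivity makes the vertices of one atom distinct, but a match of the first query
  cannot equate inner vertices of different atoms; all such equations come from the failure of the
  second query. Its words are finitely many, so each equation is local: a bad walk has one pair of
  vertices not yet known to differ, and avoiding it equates that pair. The reversed paths let such a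
  walk start at the vertex that the next zigzag vertex has to equal.

  Instructions that do not touch counter \<open>r\<close> still contribute a \<open>Unit\<close> on
  both sides, so each zigzag moves strictly forward on both paths and can be a simple path; the
  value of \<open>r\<close> is the lead of one side over the other. Prefix comparability is
  symmetric in the sides and does not see the sign of the lead. So counters are integers, only zero
  tests fail, and nonnegativity has to be programmed.

  The diagonal step is not circular: the loaded numbers occur only as increments of the counters
  \<open>0\<close> to \<open>3\<close>, and the alphabet, the side atoms and the second query depend
  on the unloaded program alone.\<close>

datatype op = Inc nat | Dec nat | Tst nat

datatype event = Unit | Mark | Stop

text \<open>\<open>Op\<close> and \<open>End\<close> label the program path, \<open>Event r\<close> the event path of counter \<open>r\<close>;
  \<open>Back\<close> and \<open>EventBack r\<close> label their reversals. The zigzag for counter \<open>r\<close> and side \<open>d\<close>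
  goes down to the event path by \<open>ZDown r d p\<close>, where \<open>p\<close> repeats the instruction just passed on
  the program path, and leaves an event vertex by \<open>ZStay\<close> or \<open>ZUp\<close>, repeating the event just
  passed on the event path.\<close>

datatype letter =
    Op op
  | End
  | Back
  | Event nat event
  | EventBack nat
  | ZStart nat bool
  | ZDown nat bool op
  | ZStay nat bool event
  | ZUp nat bool event

instance op :: countable by countable_datatype
instance event :: countable by countable_datatype
instance letter :: countable by countable_datatype

definition enc :: "letter \<Rightarrow> nat" where "enc = to_nat"

lemma enc_eq [simp]: "enc a = enc b \<longleftrightarrow> a = b"
  by (simp add: enc_def)

abbreviation enc_op :: "op \<Rightarrow> nat" where "enc_op p \<equiv> enc (Op p)"

lemma inj_enc_op: "inj enc_op"
  by (auto intro: injI)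

type_synonym state = "nat \<Rightarrow> int"

fun step :: "op \<Rightarrow> state \<Rightarrow> state set" where
  "step (Inc r) s = {s(r := s r + 1)}"
| "step (Dec r) s = {s(r := s r - 1)}"
| "step (Tst r) s = (if s r = 0 then {s} else {})"

fun run :: "op list \<Rightarrow> state \<Rightarrow> state set" where
  "run [] s = {s}"
| "run (p # w) s = (\<Union>t\<in>step p s. run w t)"

lemma run_append: "run (u @ v) s = (\<Union>t\<in>run u s. run v t)"
  by (induction u arbitrary: s) auto

definition exec :: "rexp \<Rightarrow> state \<Rightarrow> state set" where
  "exec R s = (\<Union>w\<in>{w. map enc_op w \<in> lang R}. run w s)"

lemma exec_Eps [simp]: "exec Eps s = {s}"
  by (auto simp: exec_def)

lemma exec_Letter [simp]: "exec (Letter (enc_op p)) s = step p s"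
proof -
  have "{w. map enc_op w \<in> lang (Letter (enc_op p))} = {[p]}"
    by (auto simp: map_eq_Cons_conv)
  then show ?thesis by (simp add: exec_def)
qed

lemma exec_Times: "exec (Times a b) s = (\<Union>t\<in>exec a s. exec b t)"
proof (intro equalityI subsetI)
  fix t assume "t \<in> exec (Times a b) s"
  then obtain w where w: "map enc_op w \<in> lang (Times a b)" "t \<in> run w s"
    unfolding exec_def by blast
  from w(1) obtain x y where xy: "map enc_op w = x @ y" "x \<in> lang a" "y \<in> lang b"
    by auto
  then obtain u v where "w = u @ v" "map enc_op u = x" "map enc_op v = y"
    unfolding map_eq_append_conv by blast
  with w xy show "t \<in> (\<Union>t\<in>exec a s. exec b t)"
    unfolding exec_def by (auto simp: run_append)
next
  fix t assume "t \<in> (\<Union>t\<in>exec a s. exec b t)"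
  then obtain u v t' where u: "map enc_op u \<in> lang a" "t' \<in> run u s"
    and v: "map enc_op v \<in> lang b" "t \<in> run v t'"
    unfolding exec_def by blast
  have "map enc_op (u @ v) \<in> lang (Times a b)" using u v by auto
  moreover have "t \<in> run (u @ v) s" using u v by (auto simp: run_append)
  ultimately show "t \<in> exec (Times a b) s" unfolding exec_def by blast
qed

lemma exec_Times_singleton: "exec a s = {t} \<Longrightarrow> exec (Times a b) s = exec b t"
  by (simp add: exec_Times)

lemma exec_Star: "exec (Star R) s = {t. (s, t) \<in> {(s, t). t \<in> exec R s}\<^sup>*}"
proof -
  have 1: "(s, t) \<in> {(s, t). t \<in> exec R s}\<^sup>*"
    if "map enc_op w = concat ws" "set ws \<subseteq> lang R" "t \<in> run w s" for s t w ws
    using that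
  proof (induction ws arbitrary: w s)
    case Nil
    then show ?case by simp
  next
    case (Cons x xs)
    then obtain u v where w: "w = u @ v" "map enc_op u = x" "map enc_op v = concat xs"
      by (auto simp: map_eq_append_conv)
    from Cons.prems w obtain s' where s': "s' \<in> run u s" "t \<in> run v s'"
      by (auto simp: run_append)
    then have "(s, s') \<in> {(s, t). t \<in> exec R s}"
      using w Cons.prems by (auto simp: exec_def)
    moreover have "(s', t) \<in> {(s, t). t \<in> exec R s}\<^sup>*"
      using Cons.IH w s' Cons.prems by auto
    ultimately show ?case by (rule converse_rtrancl_into_rtrancl)
  qed
  have 2: "\<exists>w ws. map enc_op w = concat ws \<and> set ws \<subseteq> lang R \<and> t \<in> run w s"
    if "(s, t) \<in> {(s, t). t \<in> exec R s}\<^sup>*" for t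
    using that
  proof (induction rule: rtrancl_induct)
    case base
    show ?case by (rule exI[of _ "[]"], rule exI[of _ "[]"]) simp
  next
    case (step t t')
    then obtain w ws where w: "map enc_op w = concat ws" "set ws \<subseteq> lang R" "t \<in> run w s"
      by blast
    from step obtain v where v: "map enc_op v \<in> lang R" "t' \<in> run v t"
      by (auto simp: exec_def)
    show ?case
      by (rule exI[of _ "w @ v"], rule exI[of _ "ws @ [map enc_op v]"])
        (use w v in \<open>auto simp: run_append\<close>)
  qed
  show ?thesis
  proof (intro set_eqI iffI)
    fix t assume "t \<in> exec (Star R) s"
    then show "t \<in> {t. (s, t) \<in> {(s, t). t \<in> exec R s}\<^sup>*}"
      using 1 by (auto simp: exec_def)
  next
    fix t assume "t \<in> {t. (s, t) \<in> {(s, t). t \<in> exec R s}\<^sup>*}"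
    then obtain w ws where "map enc_op w = concat ws" "set ws \<subseteq> lang R" "t \<in> run w s"
      using 2 by blast
    then show "t \<in> exec (Star R) s" unfolding exec_def by auto
  qed
qed

lemma exec_Star_range:
  assumes "\<And>k. exec B (f k) = {f (Suc k)}"
  shows "exec (Star B) (f 0) = range f"
proof -
  have "t \<in> range f" if "(f 0, t) \<in> {(s, t). t \<in> exec B s}\<^sup>*" for t
    using that by (induction rule: rtrancl_induct) (auto simp: assms)
  moreover have "(f 0, f k) \<in> {(s, t). t \<in> exec B s}\<^sup>*" for k
    by (induction k) (auto simp: assms intro: rtrancl_into_rtrancl)
  ultimately show ?thesis by (auto simp: exec_Star)
qed

text \<open>A star may be left after any number of rounds, so a loop is made deterministic by
  failure: \<open>test\<close> rejects every early exit and \<open>stop\<close> every round too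
  many.\<close>

lemma exec_while:
  assumes step: "\<And>k. k < n \<Longrightarrow> exec B (f k) = {f (Suc k)}" and stop: "exec B (f n) = {}"
    and test: "\<And>k. k < n \<Longrightarrow> exec T (f k) = {}"
  shows "exec (Times (Star B) T) (f 0) = exec T (f n)"
proof -
  have "t \<in> f ` {..n}" if "(f 0, t) \<in> {(s, t). t \<in> exec B s}\<^sup>*" for t
    using that
  proof (induction rule: rtrancl_induct)
    case (step t t')
    then obtain k where k: "k \<le> n" "t = f k" "t' \<in> exec B (f k)" by auto
    then have "k < n" using stop by (cases "k = n") auto
    with k show ?case using assms(1) by auto
  qed auto
  moreover have "k \<le> n \<Longrightarrow> (f 0, f k) \<in> {(s, t). t \<in> exec B s}\<^sup>*" for k
    by (induction k) (auto simp: step intro: rtrancl_into_rtrancl)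
  ultimately have "exec (Star B) (f 0) = f ` {..n}" by (auto simp: exec_Star)
  then show ?thesis
    using test by (auto simp: exec_Times le_less)
qed

section \<open>Counter macros\<close>

fun incs :: "nat list \<Rightarrow> rexp" where
  "incs [] = Eps"
| "incs (j # js) = Times (Letter (enc_op (Inc j))) (incs js)"

lemma exec_incs:
  "distinct js \<Longrightarrow> exec (incs js) s = {\<lambda>i. if i \<in> set js then s i + 1 else s i}"
  by (induction js arbitrary: s) (auto simp: exec_Times fun_eq_iff)

definition transfer :: "nat \<Rightarrow> nat list \<Rightarrow> rexp" where
  "transfer c js =
    Times (Star (Times (Letter (enc_op (Dec c))) (incs js))) (Letter (enc_op (Tst c)))"

text \<open>\<open>Dec c\<close> never fails, so the star reaches one state for each number of
  rounds, with \<open>c\<close> possibly negative. The final test selects the only state with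
  \<open>c\<close> at zero, which exists iff \<open>c\<close> started nonnegative.\<close>

lemma exec_transfer:
  assumes "distinct js" "c \<notin> set js"
  shows "exec (transfer c js) s =
    (if s c \<ge> 0 then {\<lambda>i. if i = c then 0 else if i \<in> set js then s i + s c else s i} else {})"
proof -
  define f where
    "f k = (\<lambda>i. if i = c then s c - int k else if i \<in> set js then s i + int k else s i)" for k
  have f0: "f 0 = s" by (auto simp: f_def)
  have "exec (Times (Letter (enc_op (Dec c))) (incs js)) (f k) = {f (Suc k)}" for k
    using assms by (auto simp: exec_Times exec_incs f_def fun_eq_iff)
  then have "exec (Star (Times (Letter (enc_op (Dec c))) (incs js))) s = range f"
    by (metis exec_Star_range f0)
  then have *: "exec (transfer c js) s = (\<Union>k. if s c = int k then {f k} else {})"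
    by (auto simp: transfer_def exec_Times f_def split: if_splits)
  show ?thesis
  proof (cases "s c \<ge> 0")
    case True
    then obtain n where n: "s c = int n" by (metis nonneg_int_cases)
    have "exec (transfer c js) s = {f n}" unfolding * n by auto
    then show ?thesis by (auto simp: f_def n fun_eq_iff)
  next
    case False
    then show ?thesis unfolding * by auto
  qed
qed

text \<open>Reading a counter by \<open>transfer\<close> empties it, so a second copy is parked in
  \<open>t\<close> and moved back.\<close>

definition copy :: "nat \<Rightarrow> nat \<Rightarrow> nat \<Rightarrow> rexp" where
  "copy c j t = Times (transfer c [j, t]) (transfer t [c])"

lemma exec_copy:
  assumes "distinct [c, j, t]" "s t = 0" "s c \<ge> 0"
  shows "exec (copy c j t) s = {s(j := s j + s c)}"
  using assms by (auto simp: copy_def exec_Times exec_transfer fun_eq_iff)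

text \<open>Counters can become negative, but \<open>transfer c\<close> then has no terminating run, so \<open>guard\<close>
  tests \<open>c \<ge> 0\<close>.\<close>

definition guard :: "nat \<Rightarrow> nat \<Rightarrow> rexp" where
  "guard c t = Times (transfer c [t]) (transfer t [c])"

lemma exec_guard:
  assumes "c \<noteq> t" "s t = 0"
  shows "exec (guard c t) s = (if s c \<ge> 0 then {s} else {})"
  using assms by (auto simp: guard_def exec_Times exec_transfer fun_eq_iff)

lemma exec_clear: "s c \<ge> 0 \<Longrightarrow> exec (transfer c []) s = {s(c := 0)}"
  by (auto simp: exec_transfer fun_eq_iff)

lemma exec_move: "s c \<ge> 0 \<Longrightarrow> c \<noteq> j \<Longrightarrow> exec (transfer c [j]) s = {s(c := 0, j := s j + s c)}"
  by (auto simp: exec_transfer fun_eq_iff)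

section \<open>Compilation of partial recursive functions\<close>

definition clean :: "nat \<Rightarrow> state \<Rightarrow> bool" where
  "clean m s \<longleftrightarrow> (\<forall>i. s i \<ge> 0) \<and> (\<forall>i\<ge>m. s i = 0)"

text \<open>Counters from \<open>m\<close> on are scratch space. The result must be the only final
  state, with the scratch space zero again, so that programs compose like functions. Nothing is
  promised where \<open>reval\<close> is \<open>None\<close>: the program is finally run only where
  the decider has a value.\<close>

definition computes :: "rexp \<Rightarrow> recf \<Rightarrow> nat list \<Rightarrow> nat \<Rightarrow> nat \<Rightarrow> bool" where
  "computes R f ins j m \<longleftrightarrow>
    (\<forall>s y. clean m s \<and> s j = 0 \<and> reval f (map (\<lambda>i. nat (s i)) ins) = Some y \<longrightarrow>
      exec R s = {s(j := int y)})"

lemma computesD: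
  "computes R f ins j m \<Longrightarrow> clean m s \<Longrightarrow> s j = 0 \<Longrightarrow>
    reval f (map (\<lambda>i. nat (s i)) ins) = Some y \<Longrightarrow> exec R s = {s(j := int y)}"
  by (simp add: computes_def)

text \<open>Input counters, output counter and scratch bound are universally quantified, so that the
  induction can place the programs of subterms at fresh counters.\<close>

definition compilable :: "recf \<Rightarrow> bool" where
  "compilable f \<longleftrightarrow>
    (\<forall>ins j m. set ins \<subseteq> {..<m} \<and> j < m \<and> j \<notin> set ins \<longrightarrow> (\<exists>R. computes R f ins j m))"

lemma compilableD:
  "compilable f \<Longrightarrow> set ins \<subseteq> {..<m} \<Longrightarrow> j < m \<Longrightarrow> j \<notin> set ins \<Longrightarrow>
    \<exists>R. computes R f ins j m"
  by (simp add: compilable_def)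

lemma compilable_Zero: "compilable Zero"
  unfolding compilable_def computes_def
  by (auto intro!: exI[of _ Eps] simp: fun_eq_iff)

lemma compilable_Succ: "compilable Succ"
  unfolding compilable_def
proof (intro allI impI)
  fix ins :: "nat list" and j m
  assume a: "set ins \<subseteq> {..<m} \<and> j < m \<and> j \<notin> set ins"
  show "\<exists>R. computes R Succ ins j m"
  proof (cases ins)
    case Nil
    then show ?thesis by (simp add: computes_def)
  next
    case (Cons i js)
    have "computes (Times (copy i j m) (Letter (enc_op (Inc j)))) Succ ins j m"
      unfolding computes_def
      using a Cons by (auto simp: clean_def exec_Times exec_copy fun_eq_iff)
    then show ?thesis ..
  qed
qed

lemma compilable_Proj: "compilable (Proj i)"
  unfolding compilable_def
proof (intro allI impI)
  fix ins :: "nat list" and j m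
  assume a: "set ins \<subseteq> {..<m} \<and> j < m \<and> j \<notin> set ins"
  show "\<exists>R. computes R (Proj i) ins j m"
  proof (cases "i < length ins")
    case False
    then show ?thesis by (simp add: computes_def)
  next
    case True
    then have "ins ! i \<in> set ins" by simp
    then have "ins ! i < m" "ins ! i \<noteq> j" using a by auto
    then have "computes (copy (ins ! i) j m) (Proj i) ins j m"
      unfolding computes_def
      using a True by (auto simp: clean_def exec_copy fun_eq_iff)
    then show ?thesis ..
  qed
qed


lemma clean_mono: "clean m s \<Longrightarrow> m \<le> m' \<Longrightarrow> clean m' s"
  by (auto simp: clean_def)

lemma compile_args:
  assumes "\<And>g. g \<in> set gs \<Longrightarrow> compilable g" "set ins \<subseteq> {..<b}" "b + length gs \<le> m"
  shows "\<exists>R. \<forall>s ys. clean b s \<longrightarrow>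
    those (map (\<lambda>g. reval g (map (\<lambda>i. nat (s i)) ins)) gs) = Some ys \<longrightarrow>
    exec R s = {\<lambda>i. if b \<le> i \<and> i < b + length gs then int (ys ! (i - b)) else s i}"
  using assms
proof (induction gs arbitrary: b)
  case Nil
  show ?case by (rule exI[of _ Eps]) (simp add: fun_eq_iff)
next
  case (Cons g gs)
  obtain R where R: "computes R g ins b m"
    using compilableD[of g ins m b] Cons.prems by fastforce
  have "\<And>g. g \<in> set gs \<Longrightarrow> compilable g" "set ins \<subseteq> {..<Suc b}" "Suc b + length gs \<le> m"
    using Cons.prems by (auto simp: less_Suc_eq)
  from Cons.IH[OF this] obtain R' where R': "\<And>s ys. clean (Suc b) s \<Longrightarrow>
    those (map (\<lambda>g. reval g (map (\<lambda>i. nat (s i)) ins)) gs) = Some ys \<Longrightarrow>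
    exec R' s = {\<lambda>i. if Suc b \<le> i \<and> i < Suc b + length gs then int (ys ! (i - Suc b)) else s i}"
    by blast
  show ?case
  proof (rule exI[of _ "Times R R'"], intro allI impI)
    fix s ys
    assume s: "clean b s"
      and ys: "those (map (\<lambda>g. reval g (map (\<lambda>i. nat (s i)) ins)) (g # gs)) = Some ys"
    from ys obtain y ys' where y: "reval g (map (\<lambda>i. nat (s i)) ins) = Some y"
      and ys': "those (map (\<lambda>g. reval g (map (\<lambda>i. nat (s i)) ins)) gs) = Some ys'"
      and yy: "ys = y # ys'"
      by (auto split: option.splits)
    have 1: "exec R s = {s(b := int y)}"
      using s y Cons.prems by (intro computesD[OF R]) (auto simp: clean_def)
    have eq: "map (\<lambda>i. nat ((s(b := int y)) i)) ins = map (\<lambda>i. nat (s i)) ins"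
      using Cons.prems by auto
    have "clean (Suc b) (s(b := int y))"
      using s by (auto simp: clean_def)
    then have "exec R' (s(b := int y)) =
      {\<lambda>i. if Suc b \<le> i \<and> i < Suc b + length gs then int (ys' ! (i - Suc b))
         else (s(b := int y)) i}"
      by (rule R') (use ys' eq in \<open>simp only:\<close>)
    then show "exec (Times R R') s =
      {\<lambda>i. if b \<le> i \<and> i < b + length (g # gs) then int (ys ! (i - b)) else s i}"
      using 1 yy by (auto simp: exec_Times fun_eq_iff nth_Cons' Suc_diff_Suc)
  qed
qed

lemma compile_clear:
  "\<exists>R. \<forall>s. (\<forall>i. s i \<ge> 0) \<longrightarrow> exec R s = {\<lambda>i. if m \<le> i \<and> i < m + n then 0 else s i}"
proof (induction n)
  case 0
  show ?case by (rule exI[of _ Eps]) (simp add: fun_eq_iff)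
next
  case (Suc n)
  then obtain R where
    "\<And>s. (\<forall>i. s i \<ge> 0) \<Longrightarrow> exec R s = {\<lambda>i. if m \<le> i \<and> i < m + n then 0 else s i}" by blast
  then show ?case
    by (intro exI[of _ "Times R (transfer (m + n) [])"])
      (auto simp: exec_Times exec_clear fun_eq_iff)
qed

lemma length_those: "those xs = Some ys \<Longrightarrow> length ys = length xs"
  by (induction xs arbitrary: ys) (auto split: option.splits)

lemma compilable_Comp:
  assumes "compilable f" "\<And>g. g \<in> set gs \<Longrightarrow> compilable g"
  shows "compilable (Comp f gs)"
  unfolding compilable_def
proof (intro allI impI)
  fix ins :: "nat list" and j m
  assume a: "set ins \<subseteq> {..<m} \<and> j < m \<and> j \<notin> set ins"
  define n where "n = length gs"
  obtain R1 where R1: "\<And>s ys. clean m s \<Longrightarrow>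
    those (map (\<lambda>g. reval g (map (\<lambda>i. nat (s i)) ins)) gs) = Some ys \<Longrightarrow>
    exec R1 s = {\<lambda>i. if m \<le> i \<and> i < m + n then int (ys ! (i - m)) else s i}"
    using compile_args[OF assms(2), of gs ins m "m + n"] a unfolding n_def by blast
  obtain R2 where R2: "computes R2 f [m..<m+n] j (m + n)"
    using compilableD[OF assms(1), of "[m..<m+n]" "m + n" j] a by fastforce
  obtain R3 where R3:
    "\<And>s. (\<forall>i. s i \<ge> 0) \<Longrightarrow> exec R3 s = {\<lambda>i. if m \<le> i \<and> i < m + n then 0 else s i}"
    using compile_clear[of m n] by blast
  have "computes (Times R1 (Times R2 R3)) (Comp f gs) ins j m"
    unfolding computes_def
  proof (intro allI impI, elim conjE)
    fix s y
    assume s: "clean m s" "s j = 0"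
      and y: "reval (Comp f gs) (map (\<lambda>i. nat (s i)) ins) = Some y"
    from y obtain ys where
      ys: "those (map (\<lambda>g. reval g (map (\<lambda>i. nat (s i)) ins)) gs) = Some ys"
      and fy: "reval f ys = Some y"
      by (auto split: option.splits)
    have len: "length ys = n" using length_those[OF ys] by (simp add: n_def)
    define s1 where "s1 = (\<lambda>i. if m \<le> i \<and> i < m + n then int (ys ! (i - m)) else s i)"
    have e1: "exec R1 s = {s1}" using R1[OF s(1) ys] by (simp add: s1_def)
    have "map (\<lambda>i. nat (s1 i)) [m..<m+n] = ys"
      by (rule nth_equalityI) (auto simp: len s1_def)
    moreover have "clean (m + n) s1" "s1 j = 0"
      using s a by (auto simp: clean_def s1_def)
    ultimately have e2: "exec R2 s1 = {s1(j := int y)}"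
      using fy by (intro computesD[OF R2]) auto
    have "exec R3 (s1(j := int y)) = {s(j := int y)}"
      using s a by (subst R3) (auto simp: clean_def s1_def fun_eq_iff)
    then show "exec (Times R1 (Times R2 R3)) s = {s(j := int y)}"
      using e1 e2 by (simp add: exec_Times)
  qed
  then show "\<exists>R. computes R (Comp f gs) ins j m" ..
qed

text \<open>The counter \<open>c\<close> counts the remaining rounds down, since the exit needs a
  zero test, while \<open>k\<close> counts up, since \<open>g\<close> takes the index of the round.
  The guard after \<open>Dec c\<close> makes a round beyond the last one fail, as
  \<open>exec_while\<close> demands.\<close>

lemma compilable_PrimRec:
  assumes "compilable f" "compilable g"
  shows "compilable (PrimRec f g)"
  unfolding compilable_def
proof (intro allI impI)
  fix ins :: "nat list" and j m
  assume a: "set ins \<subseteq> {..<m} \<and> j < m \<and> j \<notin> set ins"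
  show "\<exists>R. computes R (PrimRec f g) ins j m"
  proof (cases ins)
    case Nil
    then show ?thesis by (simp add: computes_def)
  next
    case (Cons i0 js)
    have i0: "i0 < m" "i0 \<noteq> j" and js: "set js \<subseteq> {..<m}" "j \<notin> set js"
      using a Cons by auto
    define acc c k out t M where
      regs: "acc = m" "c = m + 1" "k = m + 2" "out = m + 3" "t = m + 4" "M = m + 5"
    obtain Rf where Rf: "computes Rf f js acc M"
      using compilableD[OF assms(1), of js M acc] js by (fastforce simp: regs)
    obtain Rg where Rg: "computes Rg g (k # acc # js) out M"
      using compilableD[OF assms(2), of "k # acc # js" M out] js by (fastforce simp: regs)
    define body where "body = Times (Letter (enc_op (Dec c))) (Times (guard c t)
      (Times Rg (Times (transfer acc []) (Times (transfer out [acc]) (Letter (enc_op (Inc k)))))))"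
    define R where "R = Times Rf (Times (copy i0 c t)
      (Times (Times (Star body) (Letter (enc_op (Tst c))))
        (Times (transfer acc [j]) (transfer k []))))"
    have "computes R (PrimRec f g) ins j m"
      unfolding computes_def
    proof (intro allI impI, elim conjE)
      fix s y
      assume s: "clean m s" "s j = 0"
        and y: "reval (PrimRec f g) (map (\<lambda>i. nat (s i)) ins) = Some y"
      define xs where "xs = map (\<lambda>i. nat (s i)) js"
      define n where "n = nat (s i0)"
      have si0: "s i0 = int n" using s by (simp add: n_def clean_def)
      define r where "r = rec_nat (reval f xs)
        (\<lambda>m r. case r of None \<Rightarrow> None | Some y \<Rightarrow> reval g (m # y # xs))"
      have r0: "r 0 = reval f xs"
        and rSuc: "\<And>q. r (Suc q) = (case r q of None \<Rightarrow> None | Some y \<Rightarrow> reval g (q # y # xs))"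
        by (simp_all add: r_def)
      have rn: "r n = Some y" using y by (simp add: Cons r_def xs_def[symmetric] n_def)
      \<comment> \<open>\<open>None\<close> propagates upward through the recursion, so a value at
        \<open>n\<close> gives values at all earlier stages.\<close>
      have "q \<le> n \<Longrightarrow> r q \<noteq> None" for q
      proof (induction rule: inc_induct)
        case base
        show ?case using rn by simp
      next
        case (step q)
        then show ?case by (auto simp: rSuc split: option.splits)
      qed
      then have r_some: "r q = Some (the (r q))" if "q \<le> n" for q using that by simp
      define F where
        "F q = s(acc := int (the (r q)), c := int n - int q, k := int q)" for q
      have neg: "s i \<ge> 0" for i using s by (simp add: clean_def)
      have z: "s acc = 0" "s c = 0" "s k = 0" "s out = 0" "s t = 0"
        using s by (auto simp: clean_def regs)
      have ne: "j \<noteq> acc" "j \<noteq> c" "j \<noteq> k" "j \<noteq> out" "j \<noteq> t"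
        "i0 \<noteq> acc" "i0 \<noteq> c" "i0 \<noteq> k" "i0 \<noteq> out" "i0 \<noteq> t"
        "acc \<noteq> c" "acc \<noteq> k" "acc \<noteq> out" "acc \<noteq> t" "c \<noteq> k" "c \<noteq> out" "c \<noteq> t"
        "k \<noteq> out" "k \<noteq> t" "out \<noteq> t"
        "acc \<notin> set js" "c \<notin> set js" "k \<notin> set js"
        using a i0 js by (auto simp: regs)
      have big: "M \<le> i \<Longrightarrow> s i = 0 \<and> i \<noteq> acc \<and> i \<noteq> c \<and> i \<noteq> k" for i
        using s by (auto simp: clean_def regs)
      have ins_F: "map (\<lambda>i. nat (F q i)) (k # acc # js) = q # the (r q) # xs" for q
        using ne by (auto simp: F_def xs_def)
      have e1: "exec Rf s = {s(acc := int (the (r 0)))}"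
        using s r_some[of 0] z
        by (intro computesD[OF Rf]) (auto simp: r0 xs_def regs intro: clean_mono)
      have e2: "exec (copy i0 c t) (s(acc := int (the (r 0)))) = {F 0}"
        using ne z si0 by (subst exec_copy) (auto simp: F_def fun_eq_iff)
      have step: "exec body (F q) = {F (Suc q)}" if "q < n" for q
      proof -
        let ?s1 = "(F q)(c := int n - int (Suc q))"
        have rS: "reval g (q # the (r q) # xs) = Some (the (r (Suc q)))"
          using r_some[of q] r_some[of "Suc q"] that by (auto simp: rSuc split: option.splits)
        have "exec (Letter (enc_op (Dec c))) (F q) = {?s1}"
          using ne by (auto simp: F_def fun_eq_iff)
        moreover have "exec (guard c t) ?s1 = {?s1}"
          using that ne z by (subst exec_guard) (auto simp: F_def)
        moreover have "exec Rg ?s1 = {?s1(out := int (the (r (Suc q))))}"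
        proof (rule computesD[OF Rg])
          show "clean M ?s1"
            using neg big that by (auto simp: clean_def F_def)
          show "?s1 out = 0" using z ne by (auto simp: F_def)
          have "map (\<lambda>i. nat (?s1 i)) (k # acc # js) = map (\<lambda>i. nat (F q i)) (k # acc # js)"
            using ne by auto
          then show "reval g (map (\<lambda>i. nat (?s1 i)) (k # acc # js)) = Some (the (r (Suc q)))"
            using ins_F rS by (simp only:)
        qed
        ultimately show ?thesis
          using ne z that
          by (simp add: body_def exec_Times exec_clear exec_move F_def) (auto simp: fun_eq_iff F_def z)
      qed
      have stop: "exec body (F n) = {}"
        using ne z by (simp add: body_def exec_Times exec_guard F_def)
      have e3: "exec (Times (Star body) (Letter (enc_op (Tst c)))) (F 0) = {F n}"
        using exec_while[of n body F "Letter (enc_op (Tst c))", OF step stop] ne by (simp add: F_def)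
      have e4: "exec (Times (transfer acc [j]) (transfer k [])) (F n) = {s(j := int y)}"
        using ne rn z s by (auto simp: exec_Times exec_move exec_clear F_def fun_eq_iff)
      show "exec R s = {s(j := int y)}"
        unfolding R_def using exec_Times_singleton e1 e2 e3 e4 by simp
    qed
    then show ?thesis ..
  qed
qed

text \<open>\<open>Dec v\<close> followed by clearing \<open>v\<close> fails exactly if
  \<open>f\<close> returned \<open>0\<close>, so the body passes only over positive values; the exit
  runs \<open>f\<close> again and tests for \<open>0\<close>. Hence the loop can be left only at the
  least zero.\<close>

lemma compilable_Mu:
  assumes "compilable f"
  shows "compilable (Mu f)"
  unfolding compilable_def
proof (intro allI impI)
  fix ins :: "nat list" and j m
  assume a: "set ins \<subseteq> {..<m} \<and> j < m \<and> j \<notin> set ins"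
  define k v M where regs: "k = m" "v = m + 1" "M = m + 2"
  obtain Rf where Rf: "computes Rf f (k # ins) v M"
    using compilableD[OF assms(1), of "k # ins" M v] a by (fastforce simp: regs)
  define body where "body = Times Rf (Times (Letter (enc_op (Dec v)))
    (Times (transfer v []) (Letter (enc_op (Inc k)))))"
  define R where "R = Times (Times (Star body) (Times Rf (Letter (enc_op (Tst v))))) (transfer k [j])"
  have "computes R (Mu f) ins j m"
    unfolding computes_def
  proof (intro allI impI, elim conjE)
    fix s y
    assume s: "clean m s" "s j = 0"
      and y: "reval (Mu f) (map (\<lambda>i. nat (s i)) ins) = Some y"
    define xs where "xs = map (\<lambda>i. nat (s i)) ins"
    from y obtain n where n: "reval f (n # xs) = Some 0" "\<forall>q<n. \<exists>u. reval f (q # xs) = Some u"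
      and y: "y = (LEAST n. reval f (n # xs) = Some 0)"
      by (auto simp: xs_def split: if_splits)
    have y0: "reval f (y # xs) = Some 0" using n(1) unfolding y by (rule LeastI)
    have "y \<le> n" using n(1) unfolding y by (rule Least_le)
    have ypos: "\<exists>u>0. reval f (q # xs) = Some u" if "q < y" for q
    proof -
      have "reval f (q # xs) \<noteq> Some 0" using that unfolding y by (rule not_less_Least)
      moreover have "q < n" using that \<open>y \<le> n\<close> by simp
      then have "\<exists>u. reval f (q # xs) = Some u" using n(2) by simp
      then obtain u where "reval f (q # xs) = Some u" ..
      ultimately show ?thesis by simp
    qed
    define F where "F q = s(k := int q)" for q
    have neg: "s i \<ge> 0" for i using s by (simp add: clean_def)
    have z: "s k = 0" "s v = 0" using s by (auto simp: clean_def regs)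
    have ne: "j \<noteq> k" "j \<noteq> v" "k \<noteq> v" "k \<notin> set ins" using a by (auto simp: regs)
    have rf: "exec Rf (F q) = {(F q)(v := int u)}" if "reval f (q # xs) = Some u" for q u
    proof (rule computesD[OF Rf])
      show "clean M (F q)" using s by (auto simp: clean_def F_def regs)
      show "F q v = 0" using z ne by (simp add: F_def)
      have "map (\<lambda>i. nat (F q i)) (k # ins) = q # xs"
        using ne by (auto simp: F_def xs_def)
      then show "reval f (map (\<lambda>i. nat (F q i)) (k # ins)) = Some u" using that by simp
    qed
    have step: "exec body (F q) = {F (Suc q)}" if q: "q < y" for q
    proof -
      obtain u where u: "u > 0" "reval f (q # xs) = Some u" using ypos[OF q] by blast
      show ?thesis
        using u ne z by (simp add: body_def exec_Times rf[OF u(2)] exec_clear)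
          (auto simp: F_def fun_eq_iff)
    qed
    have stop: "exec body (F y) = {}"
      by (simp add: body_def exec_Times rf[OF y0] exec_transfer)
    have test: "exec (Times Rf (Letter (enc_op (Tst v)))) (F q) = {}" if q: "q < y" for q
    proof -
      obtain u where u: "u > 0" "reval f (q # xs) = Some u" using ypos[OF q] by blast
      show ?thesis using u by (simp add: exec_Times rf[OF u(2)])
    qed
    have e1: "exec (Times (Star body) (Times Rf (Letter (enc_op (Tst v))))) (F 0) = {F y}"
      using exec_while[of y body F "Times Rf (Letter (enc_op (Tst v)))", OF step stop test] z ne
      by (simp add: exec_Times rf[OF y0]) (auto simp: F_def fun_eq_iff)
    have F0: "F 0 = s" using z by (auto simp: F_def)
    have e2: "exec (transfer k [j]) (F y) = {s(j := int y)}"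
      using z ne s by (auto simp: exec_move F_def fun_eq_iff)
    show "exec R s = {s(j := int y)}"
      unfolding R_def using exec_Times_singleton[OF e1] e2 F0 by simp
  qed
  then show "\<exists>R. computes R (Mu f) ins j m" ..
qed

theorem compilable: "compilable f"
proof (induction f)
  case (Comp f gs)
  then show ?case by (intro compilable_Comp) auto
qed (auto intro: compilable_Zero compilable_Succ compilable_Proj compilable_PrimRec compilable_Mu)

section \<open>Runs and prefix-comparable event words\<close>

fun block :: "nat \<Rightarrow> bool \<Rightarrow> op \<Rightarrow> event list" where
  "block r d (Inc q) = (if q = r \<and> d then [Unit, Unit] else [Unit])"
| "block r d (Dec q) = (if q = r \<and> \<not> d then [Unit, Unit] else [Unit])"
| "block r d (Tst q) = (if q = r then [Mark] else [Unit])"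

definition events :: "nat \<Rightarrow> bool \<Rightarrow> op list \<Rightarrow> event list" where
  "events r d w = concat (map (block r d) w)"

lemma events_append [simp]: "events r d (u @ v) = events r d u @ events r d v"
  and events_Nil [simp]: "events r d [] = []"
  and events_Cons [simp]: "events r d (p # w) = block r d p @ events r d w"
  by (simp_all add: events_def)

definition balanced :: "nat \<Rightarrow> op list \<Rightarrow> bool" where
  "balanced r w \<longleftrightarrow> (\<exists>u. prefix (events r True w) u \<and> prefix (events r False w) u)"

text \<open>This is the invariant of a run: the words differ by trailing \<open>Unit\<close>s, and
  the counter is the difference of the paddings that make them equal. Padding both sides avoids a
  case distinction on the sign. A passed test has equal paddings, hence equal words, and both can be
  extended by \<open>Mark\<close>.\<close>

lemma run_events:
  assumes "t \<in> run w (\<lambda>_. 0)"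
  shows "\<exists>i j. events r True w @ replicate i Unit = events r False w @ replicate j Unit \<and>
    int j - int i = t r"
  using assms
proof (induction w arbitrary: t rule: rev_induct)
  case Nil
  then show ?case by auto
next
  case (snoc p w)
  then obtain t' where t': "t' \<in> run w (\<lambda>_. 0)" "t \<in> step p t'"
    by (auto simp: run_append)
  then obtain i j where ij: "events r True w @ replicate i Unit = events r False w @ replicate j Unit"
    "int j - int i = t' r"
    using snoc.IH by blast
  have shift: "Unit # replicate k Unit = replicate k Unit @ [Unit]" for k
    by (simp add: replicate_append_same)
  have eq: "events r True w @ Unit # replicate i Unit = events r False w @ Unit # replicate j Unit"
    unfolding shift using ij(1) by (metis append.assoc)
  then have eq2: "events r True w @ Unit # Unit # replicate i Unit =
      events r False w @ Unit # Unit # replicate j Unit"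
    unfolding shift by (metis append.assoc append_Cons shift)
  show ?case
  proof (cases p)
    case (Inc q)
    show ?thesis
    proof (cases "q = r")
      case True
      then show ?thesis
        using Inc t' ij eq2 by (intro exI[of _ i] exI[of _ "Suc j"]) auto
    next
      case False
      then show ?thesis
        using Inc t' ij eq by (intro exI[of _ i] exI[of _ j]) auto
    qed
  next
    case (Dec q)
    show ?thesis
    proof (cases "q = r")
      case True
      then show ?thesis
        using Dec t' ij eq2 by (intro exI[of _ "Suc i"] exI[of _ j]) auto
    next
      case False
      then show ?thesis
        using Dec t' ij eq by (intro exI[of _ i] exI[of _ j]) auto
    qed
  next
    case (Tst q)
    show ?thesis
    proof (cases "q = r")
      case True
      then have "i = j" "t r = 0" using Tst t' ij by (auto split: if_splits)
      then show ?thesis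
        using True Tst ij by (intro exI[of _ 0]) auto
    next
      case False
      then show ?thesis
        using Tst t' ij eq by (intro exI[of _ i] exI[of _ j]) (auto split: if_splits)
    qed
  qed
qed

text \<open>At a test this rules out that one side is ahead: the lead consists of
  \<open>Unit\<close>s and cannot begin with the \<open>Mark\<close> of the side behind.\<close>

lemma prefix_Mark_replicate: "prefix (u @ [Mark]) v \<Longrightarrow> v @ replicate j Unit \<noteq> u @ replicate i Unit"
proof
  assume "prefix (u @ [Mark]) v" "v @ replicate j Unit = u @ replicate i Unit"
  then obtain x where "u @ Mark # x @ replicate j Unit = u @ replicate i Unit"
    by (auto elim!: prefixE)
  then have "Mark \<in> set (replicate i Unit)"
    by (metis append_same_eq in_set_conv_decomp same_append_eq self_append_conv2 list.set_intros(1))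
  then show False by auto
qed

text \<open>Only a zero test can block a run. There both words end in \<open>Mark\<close>; if they
  are comparable and their parts before the \<open>Mark\<close> differ only by trailing
  \<open>Unit\<close>s, these parts are equal and the counter is zero.\<close>

lemma run_iff_balanced: "run w (\<lambda>_. 0) \<noteq> {} \<longleftrightarrow> (\<forall>r. balanced r w)"
proof
  assume "run w (\<lambda>_. 0) \<noteq> {}"
  then show "\<forall>r. balanced r w"
    unfolding balanced_def using run_events by (metis all_not_in_conv prefixI)
next
  assume "\<forall>r. balanced r w"
  then show "run w (\<lambda>_. 0) \<noteq> {}"
  proof (induction w rule: rev_induct)
    case Nil
    then show ?case by simp
  next
    case (snoc p w)
    have "balanced r w" for r
      using snoc.prems unfolding balanced_def events_append by (meson append_prefixD)
    then obtain t where t: "t \<in> run w (\<lambda>_. 0)" using snoc.IH by blast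
    show ?case
    proof (cases p)
      case (Tst r)
      from run_events[OF t] obtain i j where ij:
        "events r True w @ replicate i Unit = events r False w @ replicate j Unit"
        "int j - int i = t r" by blast
      from snoc.prems Tst obtain u where
        "prefix (events r True w @ [Mark]) u" "prefix (events r False w @ [Mark]) u"
        by (auto simp: balanced_def dest: spec[of _ r])
      then have "prefix (events r True w @ [Mark]) (events r False w @ [Mark]) \<or>
        prefix (events r False w @ [Mark]) (events r True w @ [Mark])"
        by (rule prefix_same_cases)
      then have "events r True w = events r False w"
        using prefix_Mark_replicate ij(1) by (metis append1_eq_conv prefix_snoc)
      then have "t r = 0" using ij by auto
      then show ?thesis using t Tst by (auto simp: run_append)
    qed (use t in \<open>auto simp: run_append\<close>)
  qed
qed

lemma balanced_fresh:
  assumes "\<And>p. p \<in> set w \<Longrightarrow> block r True p = [Unit] \<and> block r False p = [Unit]"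
  shows "balanced r w"
proof -
  have "events r True w = events r False w"
    using assms by (induction w) auto
  then show ?thesis by (auto simp: balanced_def)
qed

section \<open>The two queries and the identifications forced by bad words\<close>

fun op_ok :: "nat \<Rightarrow> op \<Rightarrow> bool" where
  "op_ok K (Inc r) = (r < K)"
| "op_ok K (Dec r) = (r < K)"
| "op_ok K (Tst r) = (r < K)"

fun letter_ok :: "nat \<Rightarrow> letter \<Rightarrow> bool" where
  "letter_ok K (Op p) = op_ok K p"
| "letter_ok K End = True"
| "letter_ok K Back = True"
| "letter_ok K (Event r e) = (r < K)"
| "letter_ok K (EventBack r) = (r < K)"
| "letter_ok K (ZStart r d) = (r < K)"
| "letter_ok K (ZDown r d p) = (r < K \<and> op_ok K p)"
| "letter_ok K (ZStay r d e) = (r < K)"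
| "letter_ok K (ZUp r d e) = (r < K)"

lemma finite_ops: "finite {p. op_ok K p}"
proof -
  have "{p. op_ok K p} \<subseteq> Inc ` {..<K} \<union> Dec ` {..<K} \<union> Tst ` {..<K}"
  proof
    fix p assume "p \<in> {p. op_ok K p}"
    then show "p \<in> Inc ` {..<K} \<union> Dec ` {..<K} \<union> Tst ` {..<K}" by (cases p) auto
  qed
  then show ?thesis by (rule finite_subset) auto
qed

lemma finite_event: "finite (UNIV :: event set)"
proof -
  have "(UNIV :: event set) \<subseteq> {Unit, Mark, Stop}"
    using event.exhaust by blast
  then show ?thesis by (rule finite_subset) simp
qed

lemma finite_letters: "finite {l. letter_ok K l}"
proof -
  let ?X = "Op ` {p. op_ok K p} \<union> {End, Back} \<union> (\<lambda>(r, e). Event r e) ` ({..<K} \<times> UNIV) \<union>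
      EventBack ` {..<K} \<union> (\<lambda>(r, d). ZStart r d) ` ({..<K} \<times> UNIV) \<union>
      (\<lambda>(r, d, p). ZDown r d p) ` ({..<K} \<times> UNIV \<times> {p. op_ok K p}) \<union>
      (\<lambda>(r, d, e). ZStay r d e) ` ({..<K} \<times> UNIV \<times> UNIV) \<union>
      (\<lambda>(r, d, e). ZUp r d e) ` ({..<K} \<times> UNIV \<times> UNIV)"
  have "{l. letter_ok K l} \<subseteq> ?X"
  proof
    fix l assume "l \<in> {l. letter_ok K l}"
    then show "l \<in> ?X" by (cases l) (auto simp: image_iff)
  qed
  moreover have "finite ?X"
    using finite_ops[of K] finite_event by (intro finite_UnI finite_imageI finite_cartesian_product) auto
  ultimately show ?thesis by (rule finite_subset)
qed

fun word_rexp :: "nat list \<Rightarrow> rexp" where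
  "word_rexp [] = Eps"
| "word_rexp (a # w) = Times (Letter a) (word_rexp w)"

lemma word_rexp [simp]:
  "lang (word_rexp w) = {w}" "letters (word_rexp w) = set w" "starless (word_rexp w)"
  by (induction w) auto

definition alts :: "rexp list \<Rightarrow> rexp" where
  "alts rs = foldr Alt rs Empty"

lemma alts [simp]:
  "lang (alts rs) = \<Union> (lang ` set rs)" "letters (alts rs) = \<Union> (letters ` set rs)"
  "starless (alts rs) \<longleftrightarrow> (\<forall>r\<in>set rs. starless r)"
  by (induction rs) (auto simp: alts_def)

text \<open>The enumeration is an arbitrary choice. It need not be computable, because the codes of
  the expressions built from it enter the reduction only as loaded constants.\<close>

definition fin_rexp :: "letter list set \<Rightarrow> rexp" where
  "fin_rexp W = alts (map (\<lambda>w. word_rexp (map enc w)) (SOME ws. set ws = W))"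

lemma fin_rexp:
  assumes "finite W"
  shows "lang (fin_rexp W) = map enc ` W" "letters (fin_rexp W) = (\<Union>w\<in>W. enc ` set w)"
    "starless (fin_rexp W)"
proof -
  have "set (SOME ws. set ws = W) = W"
    using finite_list[OF assms] by (rule someI_ex)
  then show "lang (fin_rexp W) = map enc ` W" "letters (fin_rexp W) = (\<Union>w\<in>W. enc ` set w)"
    "starless (fin_rexp W)"
    by (auto simp: fin_rexp_def)
qed

text \<open>One turn of the zigzag visits one event vertex per event of the block. The letter
  leaving a vertex names the event that leads to it, so the last event labels the way up.\<close>

definition segment :: "nat \<Rightarrow> bool \<Rightarrow> op \<Rightarrow> letter list" where
  "segment r d p = ZDown r d p # map (ZStay r d) (butlast (block r d p)) @ [ZUp r d (last (block r d p))]"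

definition back_rexp :: "letter \<Rightarrow> rexp" where
  "back_rexp l = Times (Letter (enc l)) (Star (Letter (enc l)))"

text \<open>\<open>Stop\<close> adds a vertex behind the last event, so that a next event vertex
  exists wherever a zigzag descends. Zigzags carry no \<open>Stop\<close>, and the comparison of
  letters then shows that a proper event was passed.\<close>

definition event_rexp :: "nat \<Rightarrow> rexp" where
  "event_rexp r = Times (Star (fin_rexp ((\<lambda>e. [Event r e]) ` {Unit, Mark}))) (Letter (enc (Event r Stop)))"

text \<open>\<open>ZStart\<close> is meant to reach the second vertex of the program path, so that a
  zigzag descends just after the instruction it repeats. The \<open>End\<close> edge of the program
  path provides the vertex reached after the last segment.\<close>

definition zigzag_rexp :: "nat \<Rightarrow> nat \<Rightarrow> bool \<Rightarrow> rexp" where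
  "zigzag_rexp K r d =
    Times (Letter (enc (ZStart r d))) (Star (fin_rexp (segment r d ` {p. op_ok K p})))"

text \<open>Variable \<open>0\<close> is the common start of all forward paths, \<open>1\<close> the
  end of the program path and of the zigzags, and \<open>2 + r\<close> the end of event path
  \<open>r\<close>.\<close>

definition counter_atoms :: "nat \<Rightarrow> nat \<Rightarrow> (nat \<times> rexp \<times> nat) list" where
  "counter_atoms K r =
    [(0, event_rexp r, 2 + r), (2 + r, back_rexp (EventBack r), 0),
     (0, zigzag_rexp K r True, 1), (0, zigzag_rexp K r False, 1)]"

definition side_atoms :: "nat \<Rightarrow> (nat \<times> rexp \<times> nat) list" where
  "side_atoms K = (1, back_rexp Back, 0) # concat (map (counter_atoms K) [0..<K])"

definition run_query :: "nat \<Rightarrow> rexp \<Rightarrow> crpq" where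
  "run_query K R = CRPQ ((0, R, 1) # side_atoms K) []"

text \<open>The first two words merge the program path with its reversal, the third does so for event
  paths; the next three keep program and event paths disjoint. The words from \<open>[Back, ZStart r d]\<close>
  to \<open>[EventBack r, ZStay r d e]\<close> force the next zigzag vertex to be the expected one, and the last
  three compare the letters of the zigzag with those of the two paths.\<close>

inductive bad :: "letter list \<Rightarrow> bool" where
  "bad [Op p, Back]"
| "bad [End, Back]"
| "bad [Event r e, EventBack r]"
| "bad [Event r e, Back]"
| "bad [Event r e, Op p]"
| "bad [Event r e, End]"
| "bad [Back, ZStart r d]"
| "bad [Back, ZDown r d p, ZUp r d e]"
| "bad [Back, ZDown r d p, ZStay r d e, ZUp r d e']"
| "bad [EventBack r, ZStart r d, ZDown r d p]"
| "bad [EventBack r, ZUp r d e, ZDown r d p]"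
| "bad [EventBack r, ZStay r d e]"
| "p \<noteq> q \<Longrightarrow> bad [Op p, ZDown r d q]"
| "e \<noteq> e' \<Longrightarrow> bad [Event r e, ZUp r d e']"
| "e \<noteq> e' \<Longrightarrow> bad [Event r e, ZStay r d e']"

definition bad_words :: "nat \<Rightarrow> letter list set" where
  "bad_words K = {ls. bad ls \<and> (\<forall>l\<in>set ls. letter_ok K l)}"

definition bad_query :: "nat \<Rightarrow> crpq" where
  "bad_query K = CRPQ [(0, fin_rexp (bad_words K), 1)] []"

lemma finite_bad_words: "finite (bad_words K)"
proof -
  have "bad ls \<Longrightarrow> length ls \<le> 4" for ls
    by (induction rule: bad.induct) auto
  then have "bad_words K \<subseteq> {ls. set ls \<subseteq> {l. letter_ok K l} \<and> length ls \<le> 4}"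
    by (auto simp: bad_words_def)
  then show ?thesis
    by (rule finite_subset) (rule finite_lists_length_le[OF finite_letters])
qed

lemma bad_not_Nil: "bad ls \<Longrightarrow> ls \<noteq> []"
  by (induction rule: bad.induct) auto

section \<open>Walks and the evaluation of the second query\<close>

fun walk :: "('v \<Rightarrow> letter \<Rightarrow> 'v \<Rightarrow> bool) \<Rightarrow> 'v list \<Rightarrow> letter list \<Rightarrow> bool" where
  "walk E [] ls = False"
| "walk E (v # vs) [] = (vs = [])"
| "walk E (v # vs) (l # ls) = (vs \<noteq> [] \<and> E v l (hd vs) \<and> walk E vs ls)"

lemma walk_iff_nth:
  "walk E vs ls \<longleftrightarrow>
    length vs = Suc (length ls) \<and> (\<forall>i<length ls. E (vs ! i) (ls ! i) (vs ! Suc i))"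
proof (induction E vs ls rule: walk.induct)
  case (3 E v vs l ls)
  then show ?case
    by (cases vs) (auto simp: less_Suc_eq_0_disj)
qed auto

definition edge :: "'v graph \<Rightarrow> 'v \<Rightarrow> letter \<Rightarrow> 'v \<Rightarrow> bool" where
  "edge G u l v \<longleftrightarrow> (u, enc l, v) \<in> snd G"

lemma simple_path_walk:
  "simple_path G u vs (map enc ls) v \<longleftrightarrow>
    walk (edge G) vs ls \<and> distinct vs \<and> set vs \<subseteq> fst G \<and> hd vs = u \<and> last vs = v"
  by (auto simp: simple_path_def is_path_def walk_iff_nth edge_def)

definition avoids :: "nat \<Rightarrow> ('v \<Rightarrow> letter \<Rightarrow> 'v \<Rightarrow> bool) \<Rightarrow> bool" where
  "avoids K E \<longleftrightarrow>
    (\<forall>vs ls. bad ls \<longrightarrow> (\<forall>l\<in>set ls. letter_ok K l) \<longrightarrow> walk E vs ls \<longrightarrow> \<not> distinct vs)"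

text \<open>The reduction keeps the empty word out of every atom; then \<open>base\<close> is the
  only applicable rule and the recursive elimination never comes into play.\<close>

lemma ainj_ans_no_eps:
  assumes "\<forall>(x, L, y)\<in>set As. [] \<notin> L"
  shows "ainj_ans G X As zs t \<longleftrightarrow>
    (\<exists>\<mu>. t = map \<mu> zs \<and> \<mu> ` X \<subseteq> fst G \<and> (\<forall>a\<in>set As. sat_atom G \<mu> a))"
proof
  assume "ainj_ans G X As zs t"
  then show "\<exists>\<mu>. t = map \<mu> zs \<and> \<mu> ` X \<subseteq> fst G \<and> (\<forall>a\<in>set As. sat_atom G \<mu> a)"
    using assms by cases auto
next
  assume "\<exists>\<mu>. t = map \<mu> zs \<and> \<mu> ` X \<subseteq> fst G \<and> (\<forall>a\<in>set As. sat_atom G \<mu> a)"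
  then obtain \<mu> where \<mu>: "t = map \<mu> zs" "\<mu> ` X \<subseteq> fst G" "\<forall>a\<in>set As. sat_atom G \<mu> a"
    by blast
  show "ainj_ans G X As zs t"
    unfolding \<mu>(1) by (rule ainj_ans.base) (use assms \<mu> in auto)
qed

lemma ainj_ans_Nil: "ainj_ans G X As zs t \<Longrightarrow> zs = [] \<Longrightarrow> t = []"
  by (induction rule: ainj_ans.induct) auto

lemma bool_ainj_subset:
  assumes "free Q1 = []" "free Q2 = []"
  shows "ainj Q1 G \<subseteq> ainj Q2 G \<longleftrightarrow> ([] \<in> ainj Q1 G \<longrightarrow> [] \<in> ainj Q2 G)"
  using assms by (auto simp: ainj_def dest: ainj_ans_Nil)

lemma bad_query_iff:
  assumes G: "snd G \<subseteq> fst G \<times> A \<times> fst G"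
  shows "[] \<in> ainj (bad_query K) G \<longleftrightarrow> \<not> avoids K (edge G)"
proof -
  have eps: "[] \<notin> lang (fin_rexp (bad_words K))"
    unfolding fin_rexp(1)[OF finite_bad_words] by (auto simp: bad_words_def dest: bad_not_Nil)
  \<comment> \<open>A walk without edges says nothing about its single vertex, so the label must be
    nonempty.\<close>
  have in_G: "set vs \<subseteq> fst G" if "walk (edge G) vs ls" "ls \<noteq> []" for vs ls
    using that
  proof (induction "edge G" vs ls rule: walk.induct)
    case (3 v vs l ls)
    have "v \<in> fst G" "hd vs \<in> fst G" using 3 G by (auto simp: edge_def)
    moreover have "set vs \<subseteq> fst G"
    proof (cases "ls = []")
      case True
      then have "vs = [hd vs]" using 3 by (cases vs) auto
      then show ?thesis using \<open>hd vs \<in> fst G\<close> by (metis empty_subsetI insert_subset list.set)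
    qed (use 3 in auto)
    ultimately show ?case by simp
  qed auto
  have "[] \<in> ainj (bad_query K) G \<longleftrightarrow>
    (\<exists>\<mu>. \<mu> ` {0, 1} \<subseteq> fst G \<and>
      (\<exists>vs. \<exists>ls\<in>bad_words K. simple_path G (\<mu> 0) vs (map enc ls) (\<mu> (1 :: nat))))"
    using eps
    by (simp add: ainj_def bad_query_def ainj_ans_no_eps sat_atom_def fin_rexp finite_bad_words
        vars_def)
  also have "\<dots> \<longleftrightarrow> (\<exists>vs. \<exists>ls\<in>bad_words K. walk (edge G) vs ls \<and> distinct vs)"
  proof
    assume "\<exists>vs. \<exists>ls\<in>bad_words K. walk (edge G) vs ls \<and> distinct vs"
    then obtain vs ls where vs: "ls \<in> bad_words K" "walk (edge G) vs ls" "distinct vs" by blast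
    then have sub: "set vs \<subseteq> fst G" using in_G bad_not_Nil by (auto simp: bad_words_def)
    have ne: "vs \<noteq> []" using vs(2) by auto
    let ?\<mu> = "\<lambda>i :: nat. if i = 0 then hd vs else last vs"
    show "\<exists>\<mu>. \<mu> ` {0, 1} \<subseteq> fst G \<and>
      (\<exists>vs. \<exists>ls\<in>bad_words K. simple_path G (\<mu> 0) vs (map enc ls) (\<mu> (1 :: nat)))"
      using vs sub ne by (intro exI[of _ ?\<mu>]) (auto simp: simple_path_walk)
  qed (auto simp: simple_path_walk)
  also have "\<dots> \<longleftrightarrow> \<not> avoids K (edge G)"
    by (auto simp: avoids_def bad_words_def)
  finally show ?thesis .
qed

text \<open>A forward edge into \<open>v\<close> followed by a \<open>b\<close>-edge out of
  \<open>v\<close> repeats a vertex. As both paths are simple, the only possible repetition is that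
  the \<open>b\<close>-edge returns to the source of the forward edge. So the reversed path retraces
  \<open>vs\<close> from its end, step by step.\<close>

lemma back_forced:
  assumes vs: "walk E vs ls" "distinct vs" "hd vs = x" "last vs = y"
    and us: "walk E us (replicate m b)" "distinct us" "hd us = y" "last us = x"
    and nodist: "\<And>l u v u'. l \<in> set ls \<Longrightarrow> E u l v \<Longrightarrow> E v b u' \<Longrightarrow> \<not> distinct [u, v, u']"
    and i: "i < length ls"
  shows "E (vs ! Suc i) b (vs ! i)"
proof -
  let ?n = "length ls"
  have len: "length vs = Suc ?n" "length us = Suc m"
    using vs us by (auto simp: walk_iff_nth)
  have x: "vs ! 0 = x" "us ! m = x" and y: "vs ! ?n = y" "us ! 0 = y"
    using vs us len by (auto simp: hd_conv_nth last_conv_nth simp flip: length_greater_0_conv)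
  have claim: "j \<le> m \<and> us ! j = vs ! (?n - j)" if "j \<le> ?n" for j
    using that
  proof (induction j)
    case 0
    then show ?case using y by simp
  next
    case (Suc j)
    then have j: "j \<le> m" "us ! j = vs ! (?n - j)" by auto
    \<comment> \<open>The reversed path ends at the first vertex of \<open>vs\<close>, so it cannot
      end while it is at a later one.\<close>
    have "j \<noteq> m"
    proof
      assume "j = m"
      then have "vs ! (?n - j) = vs ! 0" using j x by simp
      then show False using vs(2) len Suc.prems by (simp add: nth_eq_iff_index_eq)
    qed
    then have jm: "j < m" using j by simp
    have Suc_j: "?n - j = Suc (?n - Suc j)" using Suc.prems by simp
    have "E (us ! j) b (us ! Suc j)" using us(1) jm by (simp add: walk_iff_nth)
    moreover have "E (vs ! (?n - Suc j)) (ls ! (?n - Suc j)) (us ! j)"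
      using vs(1) Suc.prems unfolding j Suc_j by (simp add: walk_iff_nth)
    ultimately have "\<not> distinct [vs ! (?n - Suc j), us ! j, us ! Suc j]"
      using Suc.prems by (intro nodist) auto
    moreover have "us ! j \<noteq> us ! Suc j"
      using us(2) len jm by (simp add: nth_eq_iff_index_eq)
    moreover have "vs ! (?n - Suc j) \<noteq> us ! j"
      unfolding j using vs(2) len Suc.prems by (simp add: nth_eq_iff_index_eq)
    ultimately show ?case using jm by auto
  qed
  define j where "j = ?n - Suc i"
  have "Suc j \<le> m" "us ! Suc j = vs ! i" "us ! j = vs ! Suc i"
    using claim[of "Suc j"] claim[of j] i by (auto simp: j_def Suc_diff_Suc)
  moreover have "E (us ! j) b (us ! Suc j)" if "j < m"
    using us(1) that by (simp add: walk_iff_nth)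
  ultimately show ?thesis by simp
qed

lemma block_cases:
  obtains e where "block r d p = [e]" | "block r d p = [Unit, Unit]"
proof -
  have "(\<exists>e. block r d p = [e]) \<or> block r d p = [Unit, Unit]" by (cases p) auto
  then show thesis using that by blast
qed

lemma Stop_notin_block: "Stop \<notin> set (block r d p)"
  by (cases p) auto

text \<open>Suppose an event edge ends in an inner vertex of the program path. The bad word with
  \<open>Back\<close> equates its source with the predecessor of that vertex, and the one with
  \<open>Op\<close> or \<open>End\<close> equates it with the successor, which contradicts
  injectivity. If the edge ends in the last vertex, only \<open>Back\<close> applies; its source is
  then an inner vertex, which is the previous case or contradicts the common start.\<close>

lemma lines_disjoint:
  assumes av: "avoids K E" and r: "r < K" and w: "\<And>p. p \<in> set w \<Longrightarrow> op_ok K p"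
    and a: "\<And>i. i \<le> length w \<Longrightarrow> E (a i) ((map Op w @ [End]) ! i) (a (Suc i))"
      "\<And>i. i \<le> length w \<Longrightarrow> E (a (Suc i)) Back (a i)" "inj_on a {..Suc (length w)}"
    and e: "\<And>i. i \<le> length u \<Longrightarrow> E (e i) (Event r ((u @ [Stop]) ! i)) (e (Suc i))"
      "inj_on e {..Suc (length u)}"
    and start: "a 0 = e 0" and ne: "w \<noteq> []"
    and i: "0 < i" "i \<le> Suc (length u)" and t: "t \<le> Suc (length w)"
  shows "e i \<noteq> a t"
proof -
  have a_eq: "a i = a j \<longleftrightarrow> i = j" if "i \<le> Suc (length w)" "j \<le> Suc (length w)" for i j
    using a(3) that by (auto dest: inj_onD)
  have e_eq: "e i = e j \<longleftrightarrow> i = j" if "i \<le> Suc (length u)" "j \<le> Suc (length u)" for i j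
    using e(2) that by (auto dest: inj_onD)
  have backw: "e i = a t"
    if "e (Suc i) = a (Suc t)" "i \<le> length u" "t \<le> length w" for i t
  proof -
    have "walk E [e i, e (Suc i), a t] [Event r ((u @ [Stop]) ! i), Back]"
      using e(1)[of i] a(2)[of t] that by simp
    then have "\<not> distinct [e i, e (Suc i), a t]"
      using av r bad.intros(4) unfolding avoids_def by fastforce
    moreover have "e i \<noteq> e (Suc i)" "a (Suc t) \<noteq> a t" using that(2,3) by (simp_all add: e_eq a_eq)
    ultimately show ?thesis using that by auto
  qed
  have forw: "e i = a (Suc (Suc t))"
    if "e (Suc i) = a (Suc t)" "i \<le> length u" "t < length w" for i t
  proof -
    let ?l = "(map Op w @ [End]) ! Suc t"
    have "walk E [e i, e (Suc i), a (Suc (Suc t))] [Event r ((u @ [Stop]) ! i), ?l]"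
      using e(1)[of i] a(1)[of "Suc t"] that by simp
    moreover have "bad [Event r ((u @ [Stop]) ! i), ?l] \<and> letter_ok K ?l"
    proof (cases "Suc t < length w")
      case True
      then have "?l = Op (w ! Suc t)" by (simp add: nth_append)
      then show ?thesis using w[of "w ! Suc t"] True by (simp add: bad.intros)
    next
      case False
      then have "?l = End" using that by (simp add: nth_append)
      then show ?thesis by (simp add: bad.intros)
    qed
    ultimately have "\<not> distinct [e i, e (Suc i), a (Suc (Suc t))]"
      using av r unfolding avoids_def by fastforce
    moreover have "e i \<noteq> e (Suc i)" "a (Suc t) \<noteq> a (Suc (Suc t))"
      using that(2,3) by (simp_all add: e_eq a_eq)
    ultimately show ?thesis using that by auto
  qed
  have inner: "e (Suc i) \<noteq> a (Suc t)" if "i \<le> length u" "t < length w" for i t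
  proof
    assume "e (Suc i) = a (Suc t)"
    then have "a t = a (Suc (Suc t))" using backw[of i t] forw[of i t] that by simp
    then show False using that by (simp add: a_eq)
  qed
  obtain i' where i': "i = Suc i'" using i by (cases i) auto
  show ?thesis
  proof (cases t)
    case 0
    then show ?thesis using start i e_eq[of i 0] by simp
  next
    case (Suc t')
    show ?thesis
    proof (cases "t' < length w")
      case True
      then show ?thesis using inner i i' Suc by simp
    next
      case False
      then have t': "t' = length w" using Suc t by simp
      obtain n where n: "length w = Suc n" using ne by (cases w) auto
      show ?thesis
      proof
        assume "e i = a t"
        then have *: "e i' = a (Suc n)" using backw[of i' t'] i i' Suc t' n by simp
        show False
        proof (cases i')
          case 0
          then show False using * start a_eq[of 0 "Suc n"] n by simp
        next
          case (Suc k)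
          then show False using * inner[of k n] i i' n by simp
        qed
      qed
    qed
  qed
qed

text \<open>Induction along the zigzag, with position \<open>t\<close> on the program path and
  \<open>i\<close> on the event path. The edge from \<open>e i\<close> into the current vertex is
  part of the invariant, because the walk that identifies the next event vertex passes through it.
  Since \<open>a 0 = e 0\<close>, the \<open>ZStart\<close> edge fits this invariant with
  \<open>i = 0\<close>.\<close>

lemma zigzag_forced:
  assumes av: "avoids K E" and r: "r < K" and w: "\<And>p. p \<in> set w \<Longrightarrow> op_ok K p"
    and a: "\<And>i. i \<le> length w \<Longrightarrow> E (a i) ((map Op w @ [End]) ! i) (a (Suc i))"
      "\<And>i. i \<le> length w \<Longrightarrow> E (a (Suc i)) Back (a i)" "inj_on a {..Suc (length w)}"
    and e: "\<And>i. i \<le> length u \<Longrightarrow> E (e i) (Event r ((u @ [Stop]) ! i)) (e (Suc i))"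
      "\<And>i. i \<le> length u \<Longrightarrow> E (e (Suc i)) (EventBack r) (e i)" "inj_on e {..Suc (length u)}"
    and start: "a 0 = e 0"
    and z: "walk E (a (Suc t) # vs) (concat (map (segment r d) w'))" "distinct (a (Suc t) # vs)"
      "last (a (Suc t) # vs) = a (Suc (length w))" "\<And>p. p \<in> set w' \<Longrightarrow> op_ok K p"
    and t: "t \<le> length w" and i: "i \<le> length u"
    and enter: "E (e i) l (a (Suc t))" "l = ZStart r d \<or> (\<exists>e'. l = ZUp r d e')"
      "e i \<notin> set vs"
  shows "w' = drop t w \<and> prefix (events r d w') (drop i u)"
  using z t i enter
proof (induction w' arbitrary: t vs i l)
  case Nil
  then have "vs = []" by simp
  then have "a (Suc t) = a (Suc (length w))" using Nil by simp
  then have "t = length w" using inj_onD[OF a(3)] Nil.prems by auto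
  then show ?case by simp
next
  case (Cons p w')
  have a_eq: "a i = a j \<longleftrightarrow> i = j" if "i \<le> Suc (length w)" "j \<le> Suc (length w)" for i j
    using a(3) that by (auto dest: inj_onD)
  have e_eq: "e i = e j \<longleftrightarrow> i = j" if "i \<le> Suc (length u)" "j \<le> Suc (length u)" for i j
    using e(3) that by (auto dest: inj_onD)
  have nd: "\<not> distinct vs"
    if "bad ls" "walk E vs ls" "\<forall>l\<in>set ls. letter_ok K l" for vs ls
    using av that by (auto simp: avoids_def)
  have p: "op_ok K p" using Cons.prems by simp
  obtain z1 vs1 where vs: "vs = z1 # vs1"
    using Cons.prems(1) by (cases vs) (auto simp: segment_def)
  \<comment> \<open>The target occurs only at the end of a simple path, so with a segment still to
    come the zigzag is not there yet.\<close>
  have t: "t < length w"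
  proof (rule ccontr)
    assume "\<not> t < length w"
    then have "t = length w" using Cons.prems by simp
    then have "a (Suc t) \<in> set vs" using Cons.prems(3) vs by (metis last.simps last_in_set list.discI)
    then show False using Cons.prems(2) by simp
  qed
  have disj: "e i \<noteq> a t" if "0 < i" "i \<le> Suc (length u)" "t \<le> Suc (length w)" for i t
    using lines_disjoint[OF av r w a e(1,3) start] t that by fastforce
  have i_a: "e i \<noteq> a (Suc t)"
    using disj[of i "Suc t"] start a_eq[of 0 "Suc t"] Cons.prems(5) Cons.prems(6) t
    by (cases "i = 0") auto
  have EP: "E (a (Suc t)) (ZDown r d p) z1" using Cons.prems(1) vs by (simp add: segment_def)
  \<comment> \<open>The bad walk runs back from \<open>e (Suc i)\<close> to \<open>e i\<close>, then
    along the zigzag to \<open>a (Suc t)\<close> and \<open>z1\<close>. All coincidences except that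
    of its two ends are excluded.\<close>
  have z1: "z1 = e (Suc i)"
  proof -
    have "bad [EventBack r, l, ZDown r d p]" "letter_ok K l"
      using Cons.prems(8) r by (auto intro: bad.intros)
    then have "\<not> distinct [e (Suc i), e i, a (Suc t), z1]"
      using e(2)[of i] Cons.prems EP r p by (intro nd[of "[EventBack r, l, ZDown r d p]"]) auto
    moreover have "e (Suc i) \<noteq> e i" "e (Suc i) \<noteq> a (Suc t)"
      using disj Cons.prems t by (auto simp: e_eq)
    ultimately show ?thesis using i_a Cons.prems vs by auto
  qed
  \<comment> \<open>Here no vertices can coincide, so the word must not be bad: its two instructions
    agree.\<close>
  have p_eq: "p = w ! t"
  proof (rule ccontr)
    assume "p \<noteq> w ! t"
    then have "\<not> distinct [a t, a (Suc t), z1]"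
      using a(1)[of t] EP t p r w[of "w ! t"]
      by (intro nd[of "[Op (w ! t), ZDown r d p]"]) (auto simp: nth_append intro: bad.intros)
    moreover have "a t \<noteq> z1" using z1 disj[of "Suc i" t] Cons.prems t by auto
    ultimately show False using z1 Cons.prems vs t by (auto simp: a_eq)
  qed
  have rest: "w' = drop (Suc t) w \<and> prefix (events r d w') (drop j u)"
    if "walk E (a (Suc (Suc t)) # vs') (concat (map (segment r d) w'))"
      "distinct (a (Suc (Suc t)) # vs')" "last (a (Suc (Suc t)) # vs') = a (Suc (length w))"
      "j \<le> length u" "E (e j) (ZUp r d e') (a (Suc (Suc t)))" "e j \<notin> set vs'" for vs' j e'
    using that Cons.prems t by (intro Cons.IH[where l = "ZUp r d e'"]) auto
  have drop_w: "drop t w = p # drop (Suc t) w"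
    using t p_eq by (simp add: Cons_nth_drop_Suc)
  \<comment> \<open>The same comparison for events; a letter other than \<open>Stop\<close> in
    addition shows that the end of \<open>u\<close> has not been reached.\<close>
  have event: "i < length u \<and> u ! i = e'"
    if "E (e (Suc i)) l' z" "l' = ZUp r d e' \<or> l' = ZStay r d e'" "e' \<noteq> Stop" "i \<le> length u"
      "e i \<noteq> z" "e (Suc i) \<noteq> z"
    for i l' z e'
  proof -
    have "e' = (u @ [Stop]) ! i"
    proof (rule ccontr)
      assume "e' \<noteq> (u @ [Stop]) ! i"
      then have "bad [Event r ((u @ [Stop]) ! i), l']" "letter_ok K l'"
        using that(2) r by (auto intro: bad.intros)
      then have "\<not> distinct [e i, e (Suc i), z]"
        using e(1)[of i] that r by (intro nd[of "[Event r ((u @ [Stop]) ! i), l']"]) auto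
      then show False using that by (auto simp: e_eq)
    qed
    then show ?thesis using that by (auto simp: nth_append split: if_splits)
  qed
  show ?case
  proof (cases rule: block_cases[of r d p])
    case (1 ev)
    then have seg: "segment r d p = [ZDown r d p, ZUp r d ev]" by (simp add: segment_def)
    have ev: "ev \<noteq> Stop" using Stop_notin_block[of r d p] 1 by auto
    obtain z2 vs2 where vs1: "vs1 = z2 # vs2"
      using Cons.prems(1) vs seg by (cases vs1) auto
    have EQ: "E z1 (ZUp r d ev) z2" and wk: "walk E (z2 # vs2) (concat (map (segment r d) w'))"
      using Cons.prems(1) vs seg vs1 by auto
    \<comment> \<open>The bad walk starts one vertex ahead on the program path, steps back, and
      follows the zigzag down and up; it can only close into a cycle.\<close>
    have z2: "z2 = a (Suc (Suc t))"
    proof -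
      have "\<not> distinct [a (Suc (Suc t)), a (Suc t), z1, z2]"
        using a(2)[of "Suc t"] EP EQ t p r
        by (intro nd[of "[Back, ZDown r d p, ZUp r d ev]"]) (auto intro: bad.intros)
      moreover have "a (Suc (Suc t)) \<noteq> z1" using z1 disj[of "Suc i" "Suc (Suc t)"] Cons.prems t by auto
      ultimately show ?thesis using Cons.prems vs vs1 t by (auto simp: a_eq)
    qed
    have iu: "i < length u \<and> u ! i = ev"
      using event[of i "ZUp r d ev" z2 ev] EQ ev z1 Cons.prems vs vs1 by auto
    have "w' = drop (Suc t) w \<and> prefix (events r d w') (drop (Suc i) u)"
      using rest[of vs2 "Suc i" ev] wk z2 EQ z1 iu Cons.prems vs vs1 by auto
    moreover have "drop i u = ev # drop (Suc i) u"
      using iu Cons_nth_drop_Suc[of i u] by simp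
    ultimately show ?thesis using drop_w 1 by auto
  next
    case 2
    then have seg: "segment r d p = [ZDown r d p, ZStay r d Unit, ZUp r d Unit]" by (simp add: segment_def)
    obtain z2 z3 vs3 where vs1: "vs1 = z2 # z3 # vs3"
      using Cons.prems(1) vs seg by (cases vs1; cases "tl vs1") auto
    have EC: "E z1 (ZStay r d Unit) z2" and EQ: "E z2 (ZUp r d Unit) z3"
      and wk: "walk E (z3 # vs3) (concat (map (segment r d) w'))"
      using Cons.prems(1) vs seg vs1 by auto
    have iu: "i < length u \<and> u ! i = Unit"
      using event[of i "ZStay r d Unit" z2 Unit] EC z1 Cons.prems vs vs1 by auto
    have z2: "z2 = e (Suc (Suc i))"
    proof -
      have "\<not> distinct [e (Suc (Suc i)), e (Suc i), z2]"
        using e(2)[of "Suc i"] EC z1 iu r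
        by (intro nd[of "[EventBack r, ZStay r d Unit]"]) (auto intro: bad.intros)
      then show ?thesis using Cons.prems vs vs1 z1 iu by (auto simp: e_eq)
    qed
    have iu2: "Suc i < length u \<and> u ! Suc i = Unit"
      using event[of "Suc i" "ZUp r d Unit" z3 Unit] EQ z1 z2 iu Cons.prems vs vs1 by auto
    have z3: "z3 = a (Suc (Suc t))"
    proof -
      have "\<not> distinct [a (Suc (Suc t)), a (Suc t), z1, z2, z3]"
        using a(2)[of "Suc t"] EP EC EQ t p r
        by (intro nd[of "[Back, ZDown r d p, ZStay r d Unit, ZUp r d Unit]"]) (auto intro: bad.intros)
      moreover have "a (Suc (Suc t)) \<noteq> z1" "a (Suc (Suc t)) \<noteq> z2"
        using z1 z2 disj[of "Suc i" "Suc (Suc t)"] disj[of "Suc (Suc i)" "Suc (Suc t)"] iu t by auto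
      ultimately show ?thesis using Cons.prems vs vs1 t by (auto simp: a_eq)
    qed
    have "w' = drop (Suc t) w \<and> prefix (events r d w') (drop (Suc (Suc i)) u)"
      using rest[of vs3 "Suc (Suc i)" Unit] wk z3 z2 EQ z1 iu2 Cons.prems vs vs1 by auto
    moreover have "drop i u = Unit # Unit # drop (Suc (Suc i)) u"
      using iu iu2 Cons_nth_drop_Suc[of i u] Cons_nth_drop_Suc[of "Suc i" u] by simp
    ultimately show ?thesis using drop_w 2 by auto
  qed
qed

section \<open>From a match to a run\<close>

lemma star_fin_rexp:
  assumes "finite X"
  shows "lang (Star (fin_rexp (f ` X))) = {map enc (concat (map f w)) | w. set w \<subseteq> X}"
proof -
  have 1: "\<exists>w. concat ws = map enc (concat (map f w)) \<and> set w \<subseteq> X"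
    if "set ws \<subseteq> map enc ` f ` X" for ws
    using that
  proof (induction ws)
    case Nil
    then show ?case by (intro exI[of _ "[]"]) simp
  next
    case (Cons a ws)
    then obtain x w where "x \<in> X" "a = map enc (f x)"
      "concat ws = map enc (concat (map f w))" "set w \<subseteq> X" by auto
    then show ?case by (intro exI[of _ "x # w"]) simp
  qed
  have 2: "\<exists>ws. map enc (concat (map f w)) = concat ws \<and> set ws \<subseteq> map enc ` f ` X"
    if "set w \<subseteq> X" for w
    using that by (intro exI[of _ "map (\<lambda>x. map enc (f x)) w"]) (auto simp: map_concat comp_def)
  have "lang (fin_rexp (f ` X)) = map enc ` f ` X"
    using assms by (simp add: fin_rexp)
  then have "lang (Star (fin_rexp (f ` X))) = {concat ws | ws. set ws \<subseteq> map enc ` f ` X}"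
    by simp
  also have "\<dots> = {map enc (concat (map f w)) | w. set w \<subseteq> X}"
  proof (intro equalityI subsetI)
    fix x assume "x \<in> {concat ws | ws. set ws \<subseteq> map enc ` f ` X}"
    then obtain ws where "x = concat ws" "set ws \<subseteq> map enc ` f ` X" by blast
    then show "x \<in> {map enc (concat (map f w)) | w. set w \<subseteq> X}" using 1[of ws] by simp
  next
    fix x assume "x \<in> {map enc (concat (map f w)) | w. set w \<subseteq> X}"
    then obtain w where "x = map enc (concat (map f w))" "set w \<subseteq> X" by blast
    then show "x \<in> {concat ws | ws. set ws \<subseteq> map enc ` f ` X}" using 2[of w] by simp
  qed
  finally show ?thesis .
qed

lemma lang_star_Letter: "lang (Star (Letter a)) = {replicate m a | m. True}"
proof (intro equalityI subsetI)
  have "set ws \<subseteq> {[a]} \<Longrightarrow> concat ws = replicate (length ws) a" for ws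
    by (induction ws) auto
  then show "x \<in> {replicate m a | m. True}" if "x \<in> lang (Star (Letter a))" for x
    using that by auto
next
  fix x assume "x \<in> {replicate m a | m. True}"
  then obtain m where x: "x = replicate m a" by blast
  have "x = concat (replicate m [a])" unfolding x by (induction m) auto
  moreover have "set (replicate m [a]) \<subseteq> lang (Letter a)" by auto
  ultimately show "x \<in> lang (Star (Letter a))" unfolding lang.simps(6) by blast
qed

lemma lang_back_rexp: "lang (back_rexp l) = {map enc (replicate (Suc m) l) | m. True}"
  unfolding back_rexp_def lang.simps(5) lang_star_Letter by auto

lemma lang_event_rexp:
  "lang (event_rexp r) = {map enc (map (Event r) (u @ [Stop])) | u. set u \<subseteq> {Unit, Mark}}"
proof -
  have "concat (map (\<lambda>e. [Event r e]) u) = map (Event r) u" for u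
    by (induction u) auto
  then show ?thesis
    unfolding event_rexp_def lang.simps(5) star_fin_rexp[OF finite.insertI[OF finite.insertI[OF finite.emptyI]]]
    by auto
qed

lemma lang_zigzag_rexp:
  "lang (zigzag_rexp K r d) =
    {map enc (ZStart r d # concat (map (segment r d) w)) | w. \<forall>p\<in>set w. op_ok K p}"
  unfolding zigzag_rexp_def lang.simps(5) star_fin_rexp[OF finite_ops] by auto

lemma letters_fin_rexp_subset:
  "finite W \<Longrightarrow> \<forall>w\<in>W. \<forall>l\<in>set w. enc l \<in> A \<Longrightarrow> letters (fin_rexp W) \<subseteq> A"
  by (auto simp: fin_rexp)

lemma run_query_iff:
  assumes "[] \<notin> lang R"
  shows "[] \<in> ainj (run_query K R) G \<longleftrightarrow>
    (\<exists>\<mu>. \<mu> ` ({0, 1} \<union> (\<lambda>r. 2 + r) ` {..<K}) \<subseteq> fst G \<and>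
      (\<exists>vs. \<exists>x\<in>lang R. simple_path G (\<mu> 0) vs x (\<mu> 1)) \<and>
      (\<exists>vs. \<exists>x\<in>lang (back_rexp Back). simple_path G (\<mu> 1) vs x (\<mu> 0)) \<and>
      (\<forall>r<K. (\<exists>vs. \<exists>x\<in>lang (event_rexp r). simple_path G (\<mu> 0) vs x (\<mu> (2 + r))) \<and>
        (\<exists>vs. \<exists>x\<in>lang (back_rexp (EventBack r)). simple_path G (\<mu> (2 + r)) vs x (\<mu> 0)) \<and>
        (\<forall>d. \<exists>vs. \<exists>x\<in>lang (zigzag_rexp K r d). simple_path G (\<mu> 0) vs x (\<mu> 1))))"
proof -
  have vars: "vars (run_query K R) = {0, 1} \<union> (\<lambda>r. 2 + r) ` {..<K}"
    by (auto simp: vars_def run_query_def side_atoms_def counter_atoms_def split: prod.splits)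
  have eps: "\<forall>(x, L, y)\<in>set (map (\<lambda>(x, r, y). (x, lang r, y)) (atoms (run_query K R))). [] \<notin> L"
    using assms
    by (auto simp: run_query_def side_atoms_def counter_atoms_def lang_back_rexp lang_event_rexp
        lang_zigzag_rexp)
  have sat: "(\<forall>a\<in>set (map (\<lambda>(x, r, y). (x, lang r, y)) (atoms (run_query K R))). sat_atom G \<mu> a) \<longleftrightarrow>
      (\<exists>vs. \<exists>x\<in>lang R. simple_path G (\<mu> 0) vs x (\<mu> 1)) \<and>
      (\<exists>vs. \<exists>x\<in>lang (back_rexp Back). simple_path G (\<mu> 1) vs x (\<mu> 0)) \<and>
      (\<forall>r<K. (\<exists>vs. \<exists>x\<in>lang (event_rexp r). simple_path G (\<mu> 0) vs x (\<mu> (2 + r))) \<and>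
        (\<exists>vs. \<exists>x\<in>lang (back_rexp (EventBack r)). simple_path G (\<mu> (2 + r)) vs x (\<mu> 0)) \<and>
        (\<forall>d. \<exists>vs. \<exists>x\<in>lang (zigzag_rexp K r d). simple_path G (\<mu> 0) vs x (\<mu> 1)))" for \<mu>
    unfolding run_query_def side_atoms_def counter_atoms_def
    by (simp add: sat_atom_def ball_Un all_bool_eq Ball_def[of "{0..<K}"])
  show ?thesis
    unfolding ainj_def mem_Collect_eq ainj_ans_no_eps[OF eps] sat vars
    by (simp add: run_query_def)
qed

text \<open>Both zigzags of counter \<open>r\<close> read prefixes of the word \<open>u\<close> on
  the one event path of \<open>r\<close>, so \<open>u\<close> witnesses
  \<open>balanced r w\<close>.\<close>

lemma run_query_sound:
  assumes avo: "avoids K (edge G)" and ans: "[] \<in> ainj (run_query K R) G"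
    and R: "\<And>x. x \<in> lang R \<Longrightarrow> \<exists>w. x = map enc_op w @ [enc End] \<and> (\<forall>p\<in>set w. op_ok K p)"
  shows "\<exists>w. map enc_op w @ [enc End] \<in> lang R \<and> (\<forall>r<K. balanced r w)"
proof -
  have "[] \<notin> lang R" using R by fastforce
  from ans[unfolded run_query_iff[OF this]] obtain \<mu> where
    A: "\<exists>vs. \<exists>x\<in>lang R. simple_path G (\<mu> 0) vs x (\<mu> 1)"
    and B: "\<exists>vs. \<exists>x\<in>lang (back_rexp Back). simple_path G (\<mu> 1) vs x (\<mu> 0)"
    and rest: "\<forall>r<K. (\<exists>vs. \<exists>x\<in>lang (event_rexp r). simple_path G (\<mu> 0) vs x (\<mu> (2 + r))) \<and>
        (\<exists>vs. \<exists>x\<in>lang (back_rexp (EventBack r)). simple_path G (\<mu> (2 + r)) vs x (\<mu> 0)) \<and>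
        (\<forall>d. \<exists>vs. \<exists>x\<in>lang (zigzag_rexp K r d). simple_path G (\<mu> 0) vs x (\<mu> 1))"
    by blast
  let ?E = "edge G"
  have nd: "\<not> distinct vs" if "bad ls" "walk ?E vs ls" "\<forall>l\<in>set ls. letter_ok K l" for vs ls
    using avo that by (auto simp: avoids_def)
  from A obtain av x where x: "x \<in> lang R" "simple_path G (\<mu> 0) av x (\<mu> 1)" by blast
  from R[OF x(1)] obtain w where w: "x = map enc_op w @ [enc End]" "\<And>p. p \<in> set w \<Longrightarrow> op_ok K p"
    by blast
  let ?wl = "map Op w @ [End]"
  have "simple_path G (\<mu> 0) av (map enc ?wl) (\<mu> 1)" using x(2) w(1) by (simp add: comp_def)
  then have av: "walk ?E av ?wl" "distinct av" "hd av = \<mu> 0" "last av = \<mu> 1"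
    unfolding simple_path_walk by auto
  from B obtain bv m where "simple_path G (\<mu> 1) bv (map enc (replicate m Back)) (\<mu> 0)"
    by (auto simp only: lang_back_rexp)
  then have bv: "walk ?E bv (replicate m Back)" "distinct bv" "hd bv = \<mu> 1" "last bv = \<mu> 0"
    unfolding simple_path_walk by auto
  have len: "length av = Suc (Suc (length w))" using av(1) by (simp add: walk_iff_nth)
  have a1: "?E (av ! i) (?wl ! i) (av ! Suc i)" if "i \<le> length w" for i
    using av(1) that by (simp add: walk_iff_nth)
  have a2: "?E (av ! Suc i) Back (av ! i)" if "i \<le> length w" for i
  proof (rule back_forced[OF av bv])
    fix l u v u' assume "l \<in> set ?wl" "?E u l v" "?E v Back u'"
    then show "\<not> distinct [u, v, u']"
      using w(2) by (intro nd[of "[l, Back]"]) (auto intro: bad.intros)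
  qed (use that in auto)
  have a3: "inj_on ((!) av) {..Suc (length w)}"
    using inj_on_nth[OF av(2), of "{..Suc (length w)}"] len by auto
  have a0: "av ! 0 = \<mu> 0" using av(3) len by (cases av) auto
  have aN: "av ! Suc (length w) = \<mu> 1" using av(4) len by (cases av rule: rev_cases) (auto simp: nth_append)
  have "balanced r w" if r: "r < K" for r
  proof -
    from rest r have E: "\<exists>vs. \<exists>x\<in>lang (event_rexp r). simple_path G (\<mu> 0) vs x (\<mu> (2 + r))"
      and F: "\<exists>vs. \<exists>x\<in>lang (back_rexp (EventBack r)). simple_path G (\<mu> (2 + r)) vs x (\<mu> 0)"
      and Z: "\<And>d. \<exists>vs. \<exists>x\<in>lang (zigzag_rexp K r d). simple_path G (\<mu> 0) vs x (\<mu> 1)"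
      by blast+
    from E obtain ev u where "simple_path G (\<mu> 0) ev (map enc (map (Event r) (u @ [Stop]))) (\<mu> (2 + r))"
      unfolding lang_event_rexp by blast
    then have ev: "walk ?E ev (map (Event r) (u @ [Stop]))" "distinct ev" "hd ev = \<mu> 0"
      "last ev = \<mu> (2 + r)"
      unfolding simple_path_walk by auto
    from F obtain fv m where "simple_path G (\<mu> (2 + r)) fv (map enc (replicate m (EventBack r))) (\<mu> 0)"
      by (auto simp only: lang_back_rexp)
    then have fv: "walk ?E fv (replicate m (EventBack r))" "distinct fv" "hd fv = \<mu> (2 + r)"
      "last fv = \<mu> 0"
      unfolding simple_path_walk by auto
    have elen: "length ev = Suc (Suc (length u))" using ev(1) by (simp add: walk_iff_nth)
    have e1: "?E (ev ! i) (Event r ((u @ [Stop]) ! i)) (ev ! Suc i)" if "i \<le> length u" for i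
      using ev(1) that by (auto simp: walk_iff_nth nth_append map_nth dest!: spec[of _ i])
    have e2: "?E (ev ! Suc i) (EventBack r) (ev ! i)" if "i \<le> length u" for i
    proof (rule back_forced[OF ev fv])
      fix l u' v v' assume "l \<in> set (map (Event r) (u @ [Stop]))" "?E u' l v" "?E v (EventBack r) v'"
      then show "\<not> distinct [u', v, v']"
        using r by (intro nd[of "[l, EventBack r]"]) (auto intro: bad.intros)
    qed (use that in auto)
    have e3: "inj_on ((!) ev) {..Suc (length u)}"
      using inj_on_nth[OF ev(2), of "{..Suc (length u)}"] elen by auto
    have e0: "av ! 0 = ev ! 0" using a0 ev(3) elen by (cases ev) auto
    have "prefix (events r d w) u" for d
    proof -
      from Z[of d] obtain zv w' where w': "\<forall>p\<in>set w'. op_ok K p"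
        and "simple_path G (\<mu> 0) zv (map enc (ZStart r d # concat (map (segment r d) w'))) (\<mu> 1)"
        unfolding lang_zigzag_rexp by blast
      then have zv: "walk ?E zv (ZStart r d # concat (map (segment r d) w'))" "distinct zv"
        "hd zv = \<mu> 0" "last zv = \<mu> 1"
        unfolding simple_path_walk by auto
      then obtain z1 vs where z: "zv = av ! 0 # z1 # vs"
        using a0 by (cases zv; cases "tl zv") auto
      have ES: "?E (av ! 0) (ZStart r d) z1" using zv(1) z by simp
      \<comment> \<open>The walk \<open>[Back, ZStart r d]\<close> goes to the start and forward
        again, so it must return to the second vertex of the program path.\<close>
      have z1: "z1 = av ! Suc 0"
      proof -
        have "\<not> distinct [av ! Suc 0, av ! 0, z1]"
          using a2[of 0] ES r by (intro nd[of "[Back, ZStart r d]"]) (auto intro: bad.intros)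
        moreover have "av ! Suc 0 \<noteq> av ! 0" using av(2) len by (simp add: nth_eq_iff_index_eq)
        ultimately show ?thesis using zv(2) z by auto
      qed
      have "w' = drop 0 w \<and> prefix (events r d w') (drop 0 u)"
      proof (rule zigzag_forced[OF avo _ _ a1 a2 a3 e1 e2 e3 e0])
      qed (use r w(2) w' zv z z1 ES e0 aN in auto)
      then show ?thesis by auto
    qed
    then show ?thesis unfolding balanced_def by blast
  qed
  then show ?thesis using x w by auto
qed

section \<open>From a run to a database\<close>

definition op_node :: "nat \<Rightarrow> nat" where
  "op_node t = prod_encode (0, t)"

text \<open>All event paths start at the first vertex of the program path.\<close>

definition ev_node :: "nat \<Rightarrow> nat \<Rightarrow> nat" where
  "ev_node r i = (if i = 0 then op_node 0 else prod_encode (Suc r, i))"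

lemma node_eq [simp]:
  "op_node t = op_node t' \<longleftrightarrow> t = t'"
  "ev_node r i = ev_node q j \<longleftrightarrow> i = 0 \<and> j = 0 \<or> r = q \<and> i = j"
  "ev_node r i = op_node t \<longleftrightarrow> i = 0 \<and> t = 0"
  "op_node t = ev_node r i \<longleftrightarrow> i = 0 \<and> t = 0"
  by (auto simp: op_node_def ev_node_def)

definition pos :: "nat \<Rightarrow> bool \<Rightarrow> op list \<Rightarrow> nat \<Rightarrow> nat" where
  "pos r d w t = length (events r d (take t w))"

text \<open>The events on \<open>ZStay\<close> and \<open>ZUp\<close> are read from \<open>u\<close>
  at the index of the event edge entering the vertex that is left, hence the shifts by one. Event
  vertices do not record the instruction \<open>t\<close>; \<open>pos\<close> has to determine
  it.\<close>

fun run_edge :: "nat \<Rightarrow> op list \<Rightarrow> (nat \<Rightarrow> event list) \<Rightarrow> nat \<Rightarrow> letter \<Rightarrow> nat \<Rightarrow> bool" where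
  "run_edge K w u x (Op p) y \<longleftrightarrow>
    (\<exists>i<length w. x = op_node i \<and> p = w ! i \<and> y = op_node (Suc i))"
| "run_edge K w u x End y \<longleftrightarrow> x = op_node (length w) \<and> y = op_node (Suc (length w))"
| "run_edge K w u x Back y \<longleftrightarrow> (\<exists>i\<le>length w. x = op_node (Suc i) \<and> y = op_node i)"
| "run_edge K w u x (Event r e) y \<longleftrightarrow> r < K \<and>
    (\<exists>i\<le>length (u r). x = ev_node r i \<and> e = (u r @ [Stop]) ! i \<and> y = ev_node r (Suc i))"
| "run_edge K w u x (EventBack r) y \<longleftrightarrow> r < K \<and>
    (\<exists>i\<le>length (u r). x = ev_node r (Suc i) \<and> y = ev_node r i)"
| "run_edge K w u x (ZStart r d) y \<longleftrightarrow> r < K \<and> x = op_node 0 \<and> y = op_node 1"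
| "run_edge K w u x (ZDown r d p) y \<longleftrightarrow> r < K \<and>
    (\<exists>t<length w. x = op_node (Suc t) \<and> p = w ! t \<and> y = ev_node r (Suc (pos r d w t)))"
| "run_edge K w u x (ZStay r d e) y \<longleftrightarrow> r < K \<and>
    (\<exists>t<length w. length (block r d (w ! t)) = 2 \<and> e = u r ! pos r d w t \<and>
      x = ev_node r (Suc (pos r d w t)) \<and> y = ev_node r (Suc (Suc (pos r d w t))))"
| "run_edge K w u x (ZUp r d e) y \<longleftrightarrow> r < K \<and>
    (\<exists>t<length w. e = u r ! (pos r d w (Suc t) - 1) \<and>
      x = ev_node r (pos r d w (Suc t)) \<and> y = op_node (Suc (Suc t)))"

lemma pos_0 [simp]: "pos r d w 0 = 0"
  by (simp add: pos_def)

lemma pos_Suc: "t < length w \<Longrightarrow> pos r d w (Suc t) = pos r d w t + length (block r d (w ! t))"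
  by (simp add: pos_def take_Suc_conv_app_nth)

lemma block_length: "length (block r d p) = 1 \<or> length (block r d p) = 2"
  by (cases p) auto

text \<open>No block is empty. The strict growth yields the injectivity of \<open>pos\<close> and
  the freshness of the vertices along a zigzag.\<close>

lemma pos_less: "t < t' \<Longrightarrow> t' \<le> length w \<Longrightarrow> pos r d w t < pos r d w t'"
proof (induction t')
  case (Suc t')
  then have "pos r d w t' < pos r d w (Suc t')"
    using block_length[of r d "w ! t'"] by (auto simp: pos_Suc)
  with Suc show ?case by (cases "t = t'") auto
qed simp

lemma pos_inj: "pos r d w t = pos r d w t' \<Longrightarrow> t \<le> length w \<Longrightarrow> t' \<le> length w \<Longrightarrow> t = t'"
  using pos_less[of t t' w r d] pos_less[of t' t w r d] by (cases t t' rule: linorder_cases) auto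

text \<open>A descent at \<open>t\<close> and an ascent at \<open>t'\<close> that share an event
  vertex belong to the same instruction: for \<open>t' < t\<close> the ascent starts before this
  vertex, for \<open>t < t'\<close> beyond it.\<close>

lemma pos_Suc_eq:
  assumes "Suc (pos r d w t) = pos r d w (Suc t')" "t < length w" "t' < length w"
  shows "t = t'"
proof -
  have "\<not> t' < t"
    using pos_less[of "Suc t'" t w r d] assms by (cases "Suc t' = t") auto
  moreover have "\<not> t < t'"
    using pos_less[of t t' w r d] pos_less[of t' "Suc t'" w r d] assms by auto
  ultimately show ?thesis by simp
qed

lemma pos_block:
  assumes pre: "prefix (events r d w) u" and t: "t < length w"
  shows "pos r d w (Suc t) \<le> length u"
    and "j < length (block r d (w ! t)) \<Longrightarrow> u ! (pos r d w t + j) = block r d (w ! t) ! j"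
proof -
  have "w = take t w @ w ! t # drop (Suc t) w" using t by (rule id_take_nth_drop)
  then have "events r d w =
      events r d (take t w) @ block r d (w ! t) @ events r d (drop (Suc t) w)"
    by (metis events_append events_Cons)
  then obtain v where u: "u = events r d (take t w) @ block r d (w ! t) @ v"
    using pre by (auto elim!: prefixE)
  show "pos r d w (Suc t) \<le> length u"
    using t unfolding pos_Suc[OF t] by (simp add: pos_def u)
  show "u ! (pos r d w t + j) = block r d (w ! t) ! j" if "j < length (block r d (w ! t))"
    using that by (simp add: u pos_def nth_append)
qed

lemma walk_Nil_iff: "walk E vs [] \<longleftrightarrow> (\<exists>v. vs = [v])"
  by (cases vs) auto

lemma walk_Cons_iff:
  "walk E vs (l # ls) \<longleftrightarrow> (\<exists>v v' vs'. vs = v # v' # vs' \<and> E v l v' \<and> walk E (v' # vs') ls)"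
  by (cases vs; cases "tl vs") auto

text \<open>A bad walk either does not exist here or returns to an earlier vertex. Where it descends
  and ascends, its edges might stem from different instructions; the strict growth of
  \<open>pos\<close> excludes this. Comparison words do not occur, since both of their letters are
  read from the same index of \<open>w\<close> or \<open>u\<close>.\<close>

lemma run_edge_avoids:
  assumes pre: "\<And>r d. r < K \<Longrightarrow> prefix (events r d w) (u r)"
  shows "avoids K (run_edge K w u)"
  unfolding avoids_def
proof (intro allI impI notI)
  fix vs ls
  assume "bad ls" and wk: "walk (run_edge K w u) vs ls" and dist: "distinct vs"
  from \<open>bad ls\<close> show False
  proof cases
    case (8 r d p e)
    then obtain i t t' where "r < K" "i \<le> length w" "t < length w" "t' < length w"
      "vs = [op_node (Suc i), op_node i, ev_node r (Suc (pos r d w t)), op_node (Suc (Suc t'))]"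
      "i = Suc t" "Suc (pos r d w t) = pos r d w (Suc t')"
      using wk by (auto simp: walk_Cons_iff walk_Nil_iff)
    then show False using dist pos_Suc_eq[of r d w t t'] by simp
  next
    case (9 r d p e e')
    then obtain i t t' t'' where *: "r < K" "i \<le> length w" "t < length w" "t' < length w" "t'' < length w"
      "vs = [op_node (Suc i), op_node i, ev_node r (Suc (pos r d w t)),
        ev_node r (Suc (Suc (pos r d w t'))), op_node (Suc (Suc t''))]"
      "i = Suc t" "pos r d w t = pos r d w t'" "length (block r d (w ! t')) = 2"
      "Suc (Suc (pos r d w t')) = pos r d w (Suc t'')"
      using wk by (auto simp: walk_Cons_iff walk_Nil_iff)
    then have "pos r d w (Suc t'') = pos r d w (Suc t')" "t = t'"
      using pos_inj[of r d w t t'] by (auto simp: pos_Suc)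
    then show False using dist * pos_inj[of r d w "Suc t''" "Suc t'"] by simp
  next
    case (10 r d p)
    then show False
      using wk dist by (auto simp: walk_Cons_iff walk_Nil_iff)
  next
    case (11 r d e p)
    then show False
      using wk dist by (auto simp: walk_Cons_iff walk_Nil_iff)
  next
    case (12 r d e)
    then show False
      using wk dist by (auto simp: walk_Cons_iff walk_Nil_iff)
  next
    case (14 e e' r d)
    then obtain i t where *: "r < K" "i \<le> length (u r)" "t < length w"
      "e = (u r @ [Stop]) ! i" "e' = u r ! (pos r d w (Suc t) - 1)" "Suc i = pos r d w (Suc t)"
      using wk by (auto simp: walk_Cons_iff walk_Nil_iff)
    \<comment> \<open>The block lies within \<open>u r\<close>, so the compared event is not the
      final \<open>Stop\<close>.\<close>
    then have "i < length (u r)" "pos r d w (Suc t) - 1 = i"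
      using pos_block(1)[OF pre, of r t d] by simp_all
    then show False
      using 14 * by (simp add: nth_append)
  next
    case (15 e e' r d)
    then obtain i t where "r < K" "i \<le> length (u r)" "t < length w"
      "e = (u r @ [Stop]) ! i" "e' = u r ! pos r d w t" "i = pos r d w t"
      using wk by (auto simp: walk_Cons_iff walk_Nil_iff)
    then show False
      using 15 pos_block(1)[OF pre, of r t d] pos_less[of t "Suc t" w r d] by (auto simp: nth_append)
  qed (use wk dist in \<open>auto simp: walk_Cons_iff walk_Nil_iff\<close>)
qed

text \<open>The path is built backwards from its end. Recording that its remaining vertices lie
  strictly beyond the current position on both paths makes the vertices prepended at each step
  fresh.\<close>

lemma zigzag_path:
  assumes r: "r < K" and pre: "\<And>d. prefix (events r d w) (u r)" and t: "t \<le> length w"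
  shows "\<exists>vs. walk (run_edge K w u) (op_node (Suc t) # vs) (concat (map (segment r d) (drop t w))) \<and>
    last (op_node (Suc t) # vs) = op_node (Suc (length w)) \<and> distinct vs \<and>
    set vs \<subseteq> op_node ` {Suc t<..Suc (length w)} \<union> ev_node r ` {pos r d w t<..length (u r)}"
  using t
proof (induction rule: inc_induct)
  case base
  show ?case by (intro exI[of _ "[]"]) simp
next
  case (step t)
  then obtain vs where
    wk: "walk (run_edge K w u) (op_node (Suc (Suc t)) # vs) (concat (map (segment r d) (drop (Suc t) w)))"
    and last: "last (op_node (Suc (Suc t)) # vs) = op_node (Suc (length w))"
    and dist: "distinct vs"
    and sub: "set vs \<subseteq> op_node ` {Suc (Suc t)<..Suc (length w)} \<union>
      ev_node r ` {pos r d w (Suc t)<..length (u r)}"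
    by blast
  have drop: "drop t w = w ! t # drop (Suc t) w" using step by (simp add: Cons_nth_drop_Suc)
  have sub': "set vs \<subseteq> op_node ` {Suc t<..Suc (length w)} \<union> ev_node r ` {pos r d w t<..length (u r)}"
  proof -
    have "pos r d w t < pos r d w (Suc t)" using step by (intro pos_less) auto
    then have "ev_node r ` {pos r d w (Suc t)<..length (u r)} \<subseteq> ev_node r ` {pos r d w t<..length (u r)}"
      by (intro image_mono) auto
    moreover have "op_node ` {Suc (Suc t)<..Suc (length w)} \<subseteq> op_node ` {Suc t<..Suc (length w)}"
      by (intro image_mono) auto
    ultimately show ?thesis using subset_trans[OF sub Un_mono] by blast
  qed
  have notin: "op_node (Suc (Suc t)) \<notin> set vs" "i > 0 \<Longrightarrow> i \<le> pos r d w (Suc t) \<Longrightarrow> ev_node r i \<notin> set vs" for i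
    using sub by auto
  have le: "pos r d w (Suc t) \<le> length (u r)" using pos_block(1)[OF pre] step by blast
  have nth: "j < length (block r d (w ! t)) \<Longrightarrow> u r ! (pos r d w t + j) = block r d (w ! t) ! j" for j
    using pos_block(2)[OF pre] step by blast
  show ?case
  proof (cases rule: block_cases[of r d "w ! t"])
    case (1 e)
    then have seg: "segment r d (w ! t) = [ZDown r d (w ! t), ZUp r d e]" by (simp add: segment_def)
    have "pos r d w (Suc t) = Suc (pos r d w t)" "u r ! pos r d w t = e"
      using 1 step nth[of 0] by (simp_all add: pos_Suc)
    then show ?thesis
      using 1 r step wk last dist sub' notin le
      by (intro exI[of _ "ev_node r (Suc (pos r d w t)) # op_node (Suc (Suc t)) # vs"])
        (auto simp: drop seg)
  next
    case 2
    then have seg: "segment r d (w ! t) = [ZDown r d (w ! t), ZStay r d Unit, ZUp r d Unit]"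
      by (simp add: segment_def)
    have "pos r d w (Suc t) = Suc (Suc (pos r d w t))" "u r ! pos r d w t = Unit"
      "u r ! Suc (pos r d w t) = Unit"
      using 2 step nth[of 0] nth[of 1] by (simp_all add: pos_Suc)
    then show ?thesis
      using 2 r step wk last dist sub' notin le
      by (intro exI[of _ "ev_node r (Suc (pos r d w t)) # ev_node r (Suc (Suc (pos r d w t))) #
          op_node (Suc (Suc t)) # vs"])
        (auto simp: drop seg)
  qed
qed

definition run_database :: "nat \<Rightarrow> op list \<Rightarrow> (nat \<Rightarrow> event list) \<Rightarrow> nat graph" where
  "run_database K w u =
    (op_node ` {..Suc (length w)} \<union> (\<Union>r<K. ev_node r ` {..Suc (length (u r))}),
     {(x, enc l, y) | x l y. run_edge K w u x l y})"

lemma edge_run_database: "edge (run_database K w u) = run_edge K w u"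
  by (auto simp: fun_eq_iff edge_def run_database_def)

lemma graph_db_run_database:
  assumes pre: "\<And>r d. r < K \<Longrightarrow> prefix (events r d w) (u r)" and w: "\<forall>p\<in>set w. op_ok K p"
    and A: "finite A" "\<And>l. letter_ok K l \<Longrightarrow> enc l \<in> A"
  shows "graph_db A (run_database K w u)"
proof -
  let ?V = "fst (run_database K w u)"
  have op_in: "op_node t \<in> ?V" if "t \<le> Suc (length w)" for t
    using that by (auto simp: run_database_def)
  have ev_in: "ev_node r i \<in> ?V" if "r < K" "i \<le> Suc (length (u r))" for r i
    using that by (auto simp: run_database_def)
  have ok: "op_ok K (w ! t)" if "t < length w" for t
    using w that by simp
  have le: "pos r d w (Suc t) \<le> Suc (length (u r))" "pos r d w t \<le> length (u r)"
    if "r < K" "t < length w" for r d t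
    using pos_block(1)[OF pre, of r t d] that pos_less[of t "Suc t" w r d] by auto
  have le2: "Suc (pos r d w t) \<le> length (u r)"
    if "r < K" "t < length w" "length (block r d (w ! t)) = 2" for r d t
    using pos_block(1)[OF pre, of r t d] that by (auto simp: pos_Suc)
  have key: "letter_ok K l \<and> x \<in> ?V \<and> y \<in> ?V" if "run_edge K w u x l y" for x l y
    using that ok le le2 by (cases l) (auto intro!: op_in ev_in)
  have "snd (run_database K w u) \<subseteq> ?V \<times> A \<times> ?V"
  proof
    fix z assume "z \<in> snd (run_database K w u)"
    then obtain x l y where "z = (x, enc l, y)" "run_edge K w u x l y"
      by (auto simp: run_database_def)
    then show "z \<in> ?V \<times> A \<times> ?V" using key[of x l y] A(2)[of l] by simp
  qed
  moreover have "finite ?V" by (simp add: run_database_def)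
  ultimately show ?thesis using A(1) by (simp add: graph_db_def)
qed

lemma walk_map:
  "(\<And>i. i < length ls \<Longrightarrow> E (f i) (ls ! i) (f (Suc i))) \<Longrightarrow> walk E (map f [0..<Suc (length ls)]) ls"
  by (simp add: walk_iff_nth del: upt_Suc)

lemma run_query_complete:
  assumes pre: "\<And>r d. r < K \<Longrightarrow> prefix (events r d w) (u r)"
    and Stop: "\<And>r. Stop \<notin> set (u r)"
    and w: "\<forall>p\<in>set w. op_ok K p" and R: "map enc_op w @ [enc End] \<in> lang R" "[] \<notin> lang R"
  shows "[] \<in> ainj (run_query K R) (run_database K w u)"
proof -
  let ?G = "run_database K w u"
  let ?E = "run_edge K w u"
  let ?N = "Suc (length w)"
  define \<mu> where "\<mu> i = (if i = 0 then op_node 0 else if i = 1 then op_node ?N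
    else ev_node (i - 2) (Suc (length (u (i - 2)))))" for i :: nat
  have \<mu>: "\<mu> 0 = op_node 0" "\<mu> 1 = op_node ?N" "\<mu> (2 + r) = ev_node r (Suc (length (u r)))" for r
    by (simp_all add: \<mu>_def)
  have path: "simple_path ?G (f 0) (map f [0..<Suc (length ls)]) (map enc ls) (f (length ls))"
    if "\<And>i. i < length ls \<Longrightarrow> ?E (f i) (ls ! i) (f (Suc i))" "inj_on f {..length ls}"
      "f ` {..length ls} \<subseteq> fst ?G" for f ls
  proof -
    have "set [0..<Suc (length ls)] = {..length ls}" by (auto simp del: upt_Suc)
    then show ?thesis
      using that walk_map[of ls ?E f]
      unfolding simple_path_walk edge_run_database
      by (auto simp: distinct_map hd_map last_map simp del: upt_Suc)
  qed
  have op_in: "op_node t \<in> fst ?G" if "t \<le> ?N" for t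
    using that by (auto simp: run_database_def)
  have ev_in: "ev_node r i \<in> fst ?G" if "r < K" "i \<le> Suc (length (u r))" for r i
    using that by (auto simp: run_database_def)
  have A: "\<exists>vs. \<exists>x\<in>lang R. simple_path ?G (\<mu> 0) vs x (\<mu> 1)"
  proof -
    have "simple_path ?G (op_node 0) (map op_node [0..<Suc (length (map Op w @ [End]))])
        (map enc (map Op w @ [End])) (op_node (length (map Op w @ [End])))"
      using op_in by (intro path) (auto simp: nth_append less_Suc_eq inj_on_def)
    moreover have "map enc (map Op w @ [End]) = map enc_op w @ [enc End]" by simp
    ultimately show ?thesis using R unfolding \<mu> by (metis length_append_singleton length_map)
  qed
  have B: "\<exists>vs. \<exists>x\<in>lang (back_rexp Back). simple_path ?G (\<mu> 1) vs x (\<mu> 0)"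
  proof -
    let ?f = "\<lambda>i. op_node (?N - i)"
    have "simple_path ?G (?f 0) (map ?f [0..<Suc (length (replicate ?N Back))])
        (map enc (replicate ?N Back)) (?f (length (replicate ?N Back)))"
    proof (rule path)
      fix i assume "i < length (replicate ?N Back)"
      then show "?E (?f i) (replicate ?N Back ! i) (?f (Suc i))"
        by (auto simp: Suc_diff_le simp del: replicate_Suc intro!: exI[of _ "length w - i"])
    qed (use op_in in \<open>auto simp: inj_on_def\<close>)
    moreover have "map enc (replicate ?N Back) \<in> lang (back_rexp Back)"
      unfolding lang_back_rexp by blast
    ultimately show ?thesis unfolding \<mu> by (metis diff_self_eq_0 diff_zero length_replicate)
  qed
  have E: "\<exists>vs. \<exists>x\<in>lang (event_rexp r). simple_path ?G (\<mu> 0) vs x (\<mu> (2 + r))" if r: "r < K" for r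
  proof -
    let ?l = "map (Event r) (u r @ [Stop])"
    have "simple_path ?G (ev_node r 0) (map (ev_node r) [0..<Suc (length ?l)])
        (map enc ?l) (ev_node r (length ?l))"
    proof (rule path)
      fix i assume "i < length ?l"
      then show "?E (ev_node r i) (?l ! i) (ev_node r (Suc i))"
        using r by (subst nth_map) auto
    qed (use ev_in r in \<open>auto simp: inj_on_def\<close>)
    moreover have "set (u r) \<subseteq> {Unit, Mark}" using Stop[of r] event.exhaust by blast
    then have "map enc ?l \<in> lang (event_rexp r)" unfolding lang_event_rexp by blast
    moreover have "ev_node r 0 = op_node 0" by simp
    ultimately show ?thesis unfolding \<mu> by (metis length_append_singleton length_map)
  qed
  have F: "\<exists>vs. \<exists>x\<in>lang (back_rexp (EventBack r)). simple_path ?G (\<mu> (2 + r)) vs x (\<mu> 0)"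
    if r: "r < K" for r
  proof -
    let ?M = "Suc (length (u r))"
    let ?f = "\<lambda>i. ev_node r (?M - i)"
    have "simple_path ?G (?f 0) (map ?f [0..<Suc (length (replicate ?M (EventBack r)))])
        (map enc (replicate ?M (EventBack r))) (?f (length (replicate ?M (EventBack r))))"
    proof (rule path)
      fix i assume "i < length (replicate ?M (EventBack r))"
      then show "?E (?f i) (replicate ?M (EventBack r) ! i) (?f (Suc i))"
        using r by (auto simp: Suc_diff_le simp del: replicate_Suc intro!: exI[of _ "length (u r) - i"])
    qed (use ev_in r in \<open>auto simp: inj_on_def\<close>)
    moreover have "map enc (replicate ?M (EventBack r)) \<in> lang (back_rexp (EventBack r))"
      unfolding lang_back_rexp by blast
    moreover have "ev_node r 0 = op_node 0" by simp
    ultimately show ?thesis unfolding \<mu> by (metis diff_self_eq_0 diff_zero length_replicate)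
  qed
  have Z: "\<exists>vs. \<exists>x\<in>lang (zigzag_rexp K r d). simple_path ?G (\<mu> 0) vs x (\<mu> 1)" if r: "r < K" for r d
  proof -
    from zigzag_path[of r K w u 0 d] r pre obtain vs where
      wk: "walk ?E (op_node (Suc 0) # vs) (concat (map (segment r d) w))"
      and last: "last (op_node (Suc 0) # vs) = op_node ?N" and dist: "distinct vs"
      and sub: "set vs \<subseteq> op_node ` {Suc 0<..?N} \<union> ev_node r ` {0<..length (u r)}"
      by auto
    have "set vs \<subseteq> fst ?G"
      using sub op_in ev_in[OF r] by fastforce
    moreover have "op_node 0 \<notin> set vs" "op_node (Suc 0) \<notin> set vs" using sub by auto
    moreover have "?E (op_node 0) (ZStart r d) (op_node (Suc 0))" using r by simp
    ultimately have "simple_path ?G (op_node 0) (op_node 0 # op_node (Suc 0) # vs)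
        (map enc (ZStart r d # concat (map (segment r d) w))) (op_node ?N)"
      using wk last dist op_in unfolding simple_path_walk edge_run_database by auto
    moreover have "map enc (ZStart r d # concat (map (segment r d) w)) \<in> lang (zigzag_rexp K r d)"
      using w unfolding lang_zigzag_rexp by blast
    ultimately show ?thesis unfolding \<mu> by blast
  qed
  have "\<mu> ` ({0, 1} \<union> (\<lambda>r. 2 + r) ` {..<K}) \<subseteq> fst ?G"
    using op_in[of 0] op_in[of ?N] ev_in by (auto simp: \<mu>[simplified] \<mu>_def)
  then show ?thesis
    unfolding run_query_iff[OF R(2)] using A B E F Z by blast
qed

section \<open>The reduction\<close>

lemma containment_iff:
  assumes R: "\<And>x. x \<in> lang R \<Longrightarrow> \<exists>w. x = map enc_op w @ [enc End] \<and> (\<forall>p\<in>set w. op_ok K p)"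
    and A: "finite A" "\<And>l. letter_ok K l \<Longrightarrow> enc l \<in> A"
  shows "ainj_contained A (run_query K R) (bad_query K) \<longleftrightarrow>
    \<not> (\<exists>w. map enc_op w @ [enc End] \<in> lang R \<and> run w (\<lambda>_. 0) \<noteq> {})"
proof -
  have ok: "\<forall>p\<in>set w. op_ok K p" if "map enc_op w @ [enc End] \<in> lang R" for w
    using R[OF that] inj_enc_op by (auto dest: map_injective)
  have sub: "ainj (run_query K R) G \<subseteq> ainj (bad_query K) G \<longleftrightarrow>
    ([] \<in> ainj (run_query K R) G \<longrightarrow> [] \<in> ainj (bad_query K) G)" for G :: "nat graph"
    by (rule bool_ainj_subset) (auto simp: run_query_def bad_query_def)
  show ?thesis
  proof (intro iffI notI)
    assume cont: "ainj_contained A (run_query K R) (bad_query K)"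
    assume "\<exists>w. map enc_op w @ [enc End] \<in> lang R \<and> run w (\<lambda>_. 0) \<noteq> {}"
    then obtain w where w: "map enc_op w @ [enc End] \<in> lang R" and "\<forall>r. balanced r w"
      unfolding run_iff_balanced by blast
    \<comment> \<open>The longer of the two words, since an arbitrary common extension might contain
      \<open>Stop\<close>.\<close>
    define u where "u r = (if prefix (events r True w) (events r False w)
      then events r False w else events r True w)" for r
    have pre: "prefix (events r d w) (u r)" for r d
    proof -
      have "prefix (events r True w) (events r False w) \<or> prefix (events r False w) (events r True w)"
        using \<open>\<forall>r. balanced r w\<close> unfolding balanced_def by (meson prefix_same_cases)
      then show ?thesis by (cases d) (auto simp: u_def)
    qed
    have Stop: "Stop \<notin> set (u r)" for r
      using Stop_notin_block by (auto simp: u_def events_def)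
    let ?G = "run_database K w u"
    have db: "graph_db A ?G" using pre ok[OF w] A by (intro graph_db_run_database) auto
    have "[] \<notin> lang R" using R by fastforce
    then have "[] \<in> ainj (run_query K R) ?G"
      using pre Stop ok[OF w] w by (intro run_query_complete) auto
    moreover have "[] \<notin> ainj (bad_query K) ?G"
      using db bad_query_iff[of ?G A K] run_edge_avoids[of K w u] pre
      by (auto simp: graph_db_def edge_run_database)
    ultimately show False using cont db unfolding ainj_contained_def by blast
  next
    assume none: "\<not> (\<exists>w. map enc_op w @ [enc End] \<in> lang R \<and> run w (\<lambda>_. 0) \<noteq> {})"
    show "ainj_contained A (run_query K R) (bad_query K)"
      unfolding ainj_contained_def sub
    proof (intro allI impI)
      fix G :: "nat graph"
      assume G: "graph_db A G" and Q1: "[] \<in> ainj (run_query K R) G"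
      show "[] \<in> ainj (bad_query K) G"
      proof (rule ccontr)
        assume "[] \<notin> ainj (bad_query K) G"
        then have "avoids K (edge G)"
          using bad_query_iff[of G A K] G by (simp add: graph_db_def)
        from run_query_sound[OF this Q1 R] obtain w where
          w: "map enc_op w @ [enc End] \<in> lang R" "\<forall>r<K. balanced r w" by blast
        \<comment> \<open>The query only controls counters below \<open>K\<close>; any other counter
          is not touched by \<open>w\<close>, so its two event words are equal.\<close>
        have "balanced r w" for r
        proof (cases "r < K")
          case False
          have "block r d p = [Unit]" if "op_ok K p" for d p
            using that False by (cases p) auto
          then show ?thesis using ok[OF w(1)] by (intro balanced_fresh) auto
        qed (use w in auto)
        then show False using none w(1) run_iff_balanced by blast
      qed
    qed
  qed
qed

lemma run_query_over:
  assumes R: "letters R \<subseteq> A" and A: "\<And>l. letter_ok K l \<Longrightarrow> enc l \<in> A"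
  shows "crpq_over A (run_query K R)"
proof -
  have b: "letters (back_rexp l) \<subseteq> A" if "letter_ok K l" for l
    using A[OF that] by (simp add: back_rexp_def)
  have e: "letters (event_rexp r) \<subseteq> A" if "r < K" for r
    using A[of "Event r _"] that by (auto simp: event_rexp_def fin_rexp)
  have seg: "letter_ok K l" if "l \<in> set (segment r d p)" "r < K" "op_ok K p" for l r d p
    using that by (auto simp: segment_def)
  have z: "letters (zigzag_rexp K r d) \<subseteq> A" if "r < K" for r d
  proof -
    have "letters (fin_rexp (segment r d ` {p. op_ok K p})) \<subseteq> A"
      using A seg that by (intro letters_fin_rexp_subset) (auto simp: finite_ops)
    then show ?thesis using A[of "ZStart r d"] that by (simp add: zigzag_rexp_def)
  qed
  have "letters r \<subseteq> A" if "(x, r, y) \<in> set ((0, R, 1) # side_atoms K)" for x r y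
  proof -
    from that consider "r = R" | "r = back_rexp Back"
      | q where "q < K" "(x, r, y) \<in> set (counter_atoms K q)"
      unfolding side_atoms_def by auto
    then show ?thesis
    proof cases
      case 3
      then consider "r = event_rexp q" | "r = back_rexp (EventBack q)" | d where "r = zigzag_rexp K q d"
        unfolding counter_atoms_def by auto
      then show ?thesis using b[of "EventBack q"] e z 3(1) by cases simp_all
    qed (use R b in simp_all)
  qed
  then show ?thesis by (auto simp only: crpq_over_def run_query_def crpq.sel)
qed

lemma bad_query_over:
  assumes "\<And>l. letter_ok K l \<Longrightarrow> enc l \<in> A"
  shows "crpq_over A (bad_query K)"
  using assms letters_fin_rexp_subset[OF finite_bad_words, of K A]
  by (auto simp: crpq_over_def bad_query_def bad_words_def)

lemma bad_query_fin: "crpq_fin (bad_query K)"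
  by (simp add: crpq_fin_def bad_query_def fin_rexp finite_bad_words)

text \<open>\<open>compilable\<close> does not bound the letters of a program; those that are no instructions must
  not reach the query.\<close>

fun keep :: "nat set \<Rightarrow> rexp \<Rightarrow> rexp" where
  "keep A Empty = Empty"
| "keep A Eps = Eps"
| "keep A (Letter a) = (if a \<in> A then Letter a else Empty)"
| "keep A (Alt r s) = Alt (keep A r) (keep A s)"
| "keep A (Times r s) = Times (keep A r) (keep A s)"
| "keep A (Star r) = Star (keep A r)"

lemma lang_keep: "lang (keep A R) = lang R \<inter> lists A"
proof (induction R)
  case (Times r s)
  show ?case
  proof (intro equalityI subsetI)
    fix x assume "x \<in> lang (keep A (Times r s))"
    then obtain u v where "x = u @ v" "u \<in> lang r \<inter> lists A" "v \<in> lang s \<inter> lists A"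
      using Times by auto
    then show "x \<in> lang (Times r s) \<inter> lists A" by auto
  next
    fix x assume x: "x \<in> lang (Times r s) \<inter> lists A"
    then obtain u v where "x = u @ v" "u \<in> lang r" "v \<in> lang s" by auto
    then show "x \<in> lang (keep A (Times r s))" using x Times by auto
  qed
next
  case (Star r)
  have "concat ws \<in> lists A \<longleftrightarrow> set ws \<subseteq> lists A" for ws
    by (induction ws) auto
  then have "{concat ws | ws. set ws \<subseteq> lang r} \<inter> lists A = {concat ws | ws. set ws \<subseteq> lang r \<inter> lists A}"
    by blast
  then show ?case unfolding keep.simps lang.simps Star by simp
qed auto

lemma letters_keep: "letters (keep A R) \<subseteq> A"
  by (induction R) auto

lemma lang_letters: "x \<in> lang R \<Longrightarrow> set x \<subseteq> letters R"
proof (induction R arbitrary: x)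
  case (Star R)
  then show ?case by fastforce
qed fastforce+

lemma finite_letters_rexp: "finite (letters R)"
  by (induction R) auto

text \<open>\<open>exec\<close> considers only words that encode instructions, so removing other
  letters changes no execution.\<close>

lemma exec_keep:
  assumes "\<And>p. enc_op p \<in> letters R \<Longrightarrow> enc_op p \<in> A"
  shows "exec (keep A R) s = exec R s"
proof -
  have "map enc_op w \<in> lists A" if "map enc_op w \<in> lang R" for w
    using assms lang_letters[OF that] by fastforce
  then show ?thesis by (auto simp: exec_def lang_keep)
qed

lemma op_ok_bound:
  assumes "finite X"
  shows "\<exists>K\<ge>k. \<forall>p\<in>X. op_ok K p"
  using assms
proof induction
  case (insert p X)
  then obtain K where K: "K \<ge> k" "\<forall>p\<in>X. op_ok K p" by blast
  obtain K' where K': "op_ok K' p" by (cases p) (auto intro: that)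
  have mono: "op_ok K q \<Longrightarrow> K \<le> L \<Longrightarrow> op_ok L q" for K L q by (cases q) auto
  show ?case
    using K K' mono by (intro exI[of _ "max K K'"]) (auto intro: mono)
qed auto

section \<open>Loading numbers into counters\<close>

fun load :: "nat \<Rightarrow> nat \<Rightarrow> rexp \<Rightarrow> rexp" where
  "load i 0 T = T"
| "load i (Suc k) T = Times (Letter (enc_op (Inc i))) (load i k T)"

lemma exec_load: "exec (load i k T) s = exec T (s(i := s i + int k))"
  by (induction k arbitrary: s) (simp_all add: exec_Times algebra_simps)

text \<open>\<open>End\<close> is attached before loading, while \<open>exec\<close> concerns the
  program without it; this moves \<open>End\<close> past the loading prefix.\<close>

lemma lang_load_end:
  assumes "lang T' = {x @ [e] | x. x \<in> lang T}"
  shows "lang (load i k T') = {x @ [e] | x. x \<in> lang (load i k T)}"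
proof (induction k)
  case 0
  then show ?case using assms by simp
next
  case (Suc k)
  then show ?case by auto
qed

lemma letters_load: "letters T \<subseteq> A \<Longrightarrow> enc_op (Inc i) \<in> A \<Longrightarrow> letters (load i k T) \<subseteq> A"
  by (induction k) auto

lemma lang_load_lists: "lang T \<subseteq> lists A \<Longrightarrow> enc_op (Inc i) \<in> A \<Longrightarrow> lang (load i k T) \<subseteq> lists A"
proof (induction k)
  case (Suc k)
  have "x \<in> lists A" if x: "x \<in> lang (load i (Suc k) T)" for x
  proof -
    from x obtain y where "x = enc_op (Inc i) # y" "y \<in> lang (load i k T)" by auto
    then show ?thesis using Suc by auto
  qed
  then show ?case by blast
qed simp

section \<open>Computability of the code of an instance\<close>

definition total_recf :: "nat \<Rightarrow> (nat list \<Rightarrow> nat) \<Rightarrow> bool" where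
  "total_recf m F \<longleftrightarrow> (\<exists>f. \<forall>xs. length xs = m \<longrightarrow> reval f xs = Some (F xs))"

lemma total_recf_cong:
  "total_recf m F \<Longrightarrow> (\<And>xs. length xs = m \<Longrightarrow> F xs = G xs) \<Longrightarrow> total_recf m G"
  by (simp add: total_recf_def)

lemma total_recf_proj: "i < m \<Longrightarrow> total_recf m (\<lambda>xs. xs ! i)"
  unfolding total_recf_def by (intro exI[of _ "Proj i"]) simp

lemma total_recfE:
  assumes "total_recf m F"
  obtains f where "\<forall>xs. length xs = m \<longrightarrow> reval f xs = Some (F xs)"
  using assms unfolding total_recf_def by blast

lemma total_recf_comp1:
  assumes "total_recf 1 H" "total_recf m F"
  shows "total_recf m (\<lambda>xs. H [F xs])"
proof -
  obtain h where h: "\<forall>xs. length xs = 1 \<longrightarrow> reval h xs = Some (H xs)"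
    using total_recfE[OF assms(1)] .
  obtain f where f: "\<forall>xs. length xs = m \<longrightarrow> reval f xs = Some (F xs)"
    using total_recfE[OF assms(2)] .
  show ?thesis unfolding total_recf_def by (intro exI[of _ "Comp h [f]"]) (simp add: f h)
qed

lemma total_recf_comp2:
  assumes "total_recf 2 H" "total_recf m F" "total_recf m G"
  shows "total_recf m (\<lambda>xs. H [F xs, G xs])"
proof -
  obtain h where h: "\<forall>xs. length xs = 2 \<longrightarrow> reval h xs = Some (H xs)"
    using total_recfE[OF assms(1)] .
  obtain f where f: "\<forall>xs. length xs = m \<longrightarrow> reval f xs = Some (F xs)"
    using total_recfE[OF assms(2)] .
  obtain g where g: "\<forall>xs. length xs = m \<longrightarrow> reval g xs = Some (G xs)"
    using total_recfE[OF assms(3)] .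
  show ?thesis unfolding total_recf_def by (intro exI[of _ "Comp h [f, g]"]) (simp add: f g h)
qed

lemma total_recf_Suc:
  assumes "total_recf m F"
  shows "total_recf m (\<lambda>xs. Suc (F xs))"
proof -
  have "total_recf 1 (\<lambda>xs. Suc (xs ! 0))"
    unfolding total_recf_def by (intro exI[of _ Succ]) (auto simp: length_Suc_conv)
  from total_recf_comp1[OF this assms] show ?thesis by simp
qed

lemma total_recf_const: "total_recf m (\<lambda>_. c)"
proof (induction c)
  case 0
  show ?case unfolding total_recf_def by (intro exI[of _ Zero]) simp
qed (rule total_recf_Suc)

lemma total_recf_iter:
  assumes "total_recf 1 H"
  shows "total_recf 2 (\<lambda>xs. ((\<lambda>y. H [y]) ^^ (xs ! 0)) (xs ! 1))"
proof -
  obtain h where h: "\<forall>xs. length xs = 1 \<longrightarrow> reval h xs = Some (H xs)"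
    using total_recfE[OF assms] .
  have "rec_nat (Some y) (\<lambda>m r. case r of None \<Rightarrow> None | Some z \<Rightarrow> reval h [z]) n =
      Some (((\<lambda>y. H [y]) ^^ n) y)" for n y
    by (induction n) (simp_all add: h)
  \<comment> \<open>The step function receives the round, the previous value and the parameter;
    \<open>Proj 1\<close> selects the previous value.\<close>
  then have "reval (PrimRec (Proj 0) (Comp h [Proj 1])) [n, y] = Some (((\<lambda>y. H [y]) ^^ n) y)" for n y
    by simp
  then show ?thesis
    unfolding total_recf_def
    by (intro exI[of _ "PrimRec (Proj 0) (Comp h [Proj 1])"])
      (auto simp: numeral_2_eq_2 length_Suc_conv simp del: reval.simps)
qed

lemma total_recf_add:
  assumes "total_recf m F" "total_recf m G"
  shows "total_recf m (\<lambda>xs. F xs + G xs)"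
proof -
  have "total_recf 1 (\<lambda>xs. Suc (xs ! 0))" by (intro total_recf_Suc total_recf_proj) simp
  from total_recf_comp2[OF total_recf_iter[OF this] assms] show ?thesis
    by (rule total_recf_cong) (simp add: Suc_funpow)
qed

text \<open>Needed because \<open>prod_encode\<close> is Cantor pairing,
  \<open>triangle (m + n) + m\<close>.\<close>

lemma total_recf_triangle:
  assumes "total_recf m F"
  shows "total_recf m (\<lambda>xs. triangle (F xs))"
proof -
  have "total_recf 2 (\<lambda>xs. xs ! 1 + Suc (xs ! 0))"
    by (intro total_recf_Suc total_recf_proj total_recf_add) simp_all
  then obtain g where g: "\<forall>xs. length xs = 2 \<longrightarrow> reval g xs = Some (xs ! 1 + Suc (xs ! 0))"
    by (rule total_recfE)
  have "rec_nat (Some 0) (\<lambda>m r. case r of None \<Rightarrow> None | Some y \<Rightarrow> reval g (m # y # [])) n =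
      Some (triangle n)" for n
    by (induction n) (simp_all add: g)
  then have "total_recf 1 (\<lambda>xs. triangle (xs ! 0))"
    unfolding total_recf_def
    by (intro exI[of _ "PrimRec Zero g"]) (auto simp: length_Suc_conv)
  from total_recf_comp1[OF this assms] show ?thesis by simp
qed

lemma total_recf_prod_encode:
  assumes "total_recf m F" "total_recf m G"
  shows "total_recf m (\<lambda>xs. prod_encode (F xs, G xs))"
  using total_recf_add[OF total_recf_triangle[OF total_recf_add[OF assms]] assms(1)]
  by (simp add: prod_encode_def)

text \<open>\<open>load\<close> wraps a program in the same context once per increment, so on codes
  it is an iterate of one fixed map and hence primitive recursive in both arguments.\<close>

definition load_code :: "nat \<Rightarrow> nat \<Rightarrow> nat \<Rightarrow> nat" where
  "load_code i k =
    (\<lambda>y. prod_encode (4, prod_encode (rexp_code (Letter (enc_op (Inc i))), y))) ^^ k"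

lemma rexp_code_load: "rexp_code (load i k T) = load_code i k (rexp_code T)"
  unfolding load_code_def by (induction k) simp_all

lemma total_recf_load_code:
  assumes "total_recf m F" "total_recf m G"
  shows "total_recf m (\<lambda>xs. load_code i (F xs) (G xs))"
proof -
  have "total_recf 1 (\<lambda>xs. prod_encode (4, prod_encode (rexp_code (Letter (enc_op (Inc i))), xs ! 0)))"
    by (intro total_recf_prod_encode total_recf_const total_recf_proj) simp
  from total_recf_comp2[OF total_recf_iter[OF this] assms] show ?thesis
    by (rule total_recf_cong) (simp add: load_code_def)
qed

text \<open>The arguments are the alphabet size, the code of the program, the code of the list of the
  atoms other than the program atom, and the code of the second query.\<close>

definition instance_code :: "nat list \<Rightarrow> nat" where
  "instance_code xs = prod_encode (xs ! 0, prod_encode (prod_encode (Suc (prod_encode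
    (prod_encode (0, prod_encode
      (load_code 0 (xs ! 0) (load_code 1 (xs ! 1) (load_code 2 (xs ! 2) (load_code 3 (xs ! 3) (xs ! 1)))),
       1)), xs ! 2)), 0), xs ! 3))"

lemma total_recf_instance_code: "total_recf 4 instance_code"
  unfolding instance_code_def[abs_def]
  by (intro total_recf_prod_encode total_recf_Suc total_recf_const total_recf_proj
      total_recf_load_code) simp_all

section \<open>Diagonalisation\<close>

theorem crpq_fin_containment_undecidable:
  "\<not> decidable_on {(n, Q1, Q2) \<in> containment_inputs. crpq_fin Q2} input_code containment_holds"
proof
  let ?D = "{(n, Q1, Q2) \<in> containment_inputs. crpq_fin Q2}"
  assume "decidable_on ?D input_code containment_holds"
  then obtain f where f: "\<And>i. i \<in> ?D \<Longrightarrow> reval f [input_code i] = Some (if containment_holds i then 1 else 0)"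
    unfolding decidable_on_def by blast
  obtain g where g: "\<forall>xs. length xs = 4 \<longrightarrow> reval g xs = Some (instance_code xs)"
    using total_recfE[OF total_recf_instance_code] .
  \<comment> \<open>Counters \<open>0\<close> to \<open>3\<close> hold the arguments of
    \<open>instance_code\<close>, counter \<open>4\<close> receives the answer, and scratch space
    starts at \<open>5\<close>.\<close>
  obtain R where R: "computes R (Comp f [g]) [0, 1, 2, 3] 4 5"
    using compilableD[OF compilable[of "Comp f [g]"], of "[0, 1, 2, 3]" 5 4] by auto
  \<comment> \<open>The appended instructions let the program halt iff the answer is
    \<open>1\<close>, that is, iff the decider claims containment.\<close>
  define R' where "R' = Times R (Times (Letter (enc_op (Dec 4))) (Letter (enc_op (Tst 4))))"
  have "finite {p. enc_op p \<in> letters R'}"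
    using finite_vimageI[OF finite_letters_rexp[of R'] inj_enc_op] by (simp add: vimage_def)
  \<comment> \<open>The bound \<open>5\<close> admits the increments of the loading prefix.
    \<open>K\<close> depends on \<open>R'\<close> only and is fixed before the numbers to be
    loaded.\<close>
  from op_ok_bound[OF this, of 5] obtain K where
    K: "K \<ge> 5" "\<And>p. enc_op p \<in> letters R' \<Longrightarrow> op_ok K p" by blast
  define A where "A = enc_op ` {p. op_ok K p}"
  define prog where "prog = keep A R'"
  have exec_prog: "exec prog s = exec R' s" for s
    unfolding prog_def using K by (intro exec_keep) (auto simp: A_def)
  obtain n where n: "\<And>l. letter_ok K l \<Longrightarrow> enc l < n"
    using finite_imageI[OF finite_letters[of K], of enc] by (auto simp: finite_nat_set_iff_bounded)
  let ?T = "Times prog (Letter (enc End))"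
  \<comment> \<open>This number is used twice: as the value loaded into counter \<open>1\<close> and
    as the program to which \<open>instance_code\<close> prepends the loading prefix. This
    self-application takes the place of a fixed-point theorem.\<close>
  define c where "c = rexp_code ?T"
  define a where "a = list_encode (map atom_code (side_atoms K))"
  define q where "q = crpq_code (bad_query K)"
  let ?load = "\<lambda>T. load 0 n (load 1 c (load 2 a (load 3 q T)))"
  define Q where "Q = run_query K (?load ?T)"
  have inc: "enc_op (Inc i) \<in> A" if "i < 5" for i
    using that K(1) by (auto simp: A_def)
  have lang_load: "lang (?load ?T) = {x @ [enc End] | x. x \<in> lang (?load prog)}"
    by (intro lang_load_end) auto
  have "lang prog \<subseteq> lists A" by (auto simp: prog_def lang_keep)
  then have lists: "lang (?load prog) \<subseteq> lists A"
    using inc by (intro lang_load_lists) simp_all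
  have form: "\<exists>w. x = map enc_op w @ [enc End] \<and> (\<forall>p\<in>set w. op_ok K p)" if x: "x \<in> lang (?load ?T)" for x
  proof -
    obtain y where y: "x = y @ [enc End]" "y \<in> lang (?load prog)"
      using x unfolding lang_load by blast
    then have "y \<in> lists A" using lists by blast
    then have "y \<in> map enc_op ` lists {p. op_ok K p}" unfolding A_def lists_image .
    then show ?thesis using y by auto
  qed
  have A_n: "A \<subseteq> {..<n}" using n[of "Op _"] by (auto simp: A_def)
  have "letters ?T \<subseteq> {..<n}"
    using letters_keep[of A R'] A_n n[of End] by (auto simp: prog_def)
  moreover have "enc_op (Inc i) \<in> {..<n}" if "i < 5" for i
    using inc[OF that] A_n by blast
  ultimately have "letters (?load ?T) \<subseteq> {..<n}"
    by (intro letters_load) simp_all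
  then have D: "(n, Q, bad_query K) \<in> ?D"
    using run_query_over[of "?load ?T" "{..<n}" K] bad_query_over[of K "{..<n}"] bad_query_fin n
    by (simp add: containment_inputs_def Q_def)
  have "atom_code (0, T, 1) = prod_encode (0, prod_encode (rexp_code T, 1))" for T
    by (simp add: atom_code_def)
  then have "crpq_code Q =
      prod_encode (Suc (prod_encode (prod_encode (0, prod_encode (rexp_code (?load ?T), 1)), a)), 0)"
    by (simp only: Q_def crpq_code_def run_query_def a_def crpq.sel list.map list_encode.simps)
  moreover have "rexp_code (?load ?T) =
      load_code 0 n (load_code 1 c (load_code 2 a (load_code 3 q c)))"
    unfolding rexp_code_load by (simp only: c_def)
  ultimately have "instance_code [n, c, a, q] = input_code (n, Q, bad_query K)"
    by (simp add: instance_code_def input_code_def q_def)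
  then have val: "reval (Comp f [g]) [n, c, a, q] =
      Some (if containment_holds (n, Q, bad_query K) then 1 else 0)"
    using f[OF D] g by simp
  \<comment> \<open>The state in which the loading prefix leaves the counters.\<close>
  define s :: state where
    "s = (\<lambda>_. 0)(0 := int n, 1 := int c, 2 := int a, 3 := int q)"
  have "exec R s = {s(4 := int (if containment_holds (n, Q, bad_query K) then 1 else 0))}"
  proof (rule computesD[OF R])
    show "clean 5 s" by (auto simp: clean_def s_def)
    show "reval (Comp f [g]) (map (\<lambda>i. nat (s i)) [0, 1, 2, 3]) =
      Some (if containment_holds (n, Q, bad_query K) then 1 else 0)"
      using val by (simp add: s_def)
  qed (simp add: s_def)
  then have halts: "exec R' s \<noteq> {} \<longleftrightarrow> containment_holds (n, Q, bad_query K)"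
    by (simp add: R'_def exec_Times)
  have "containment_holds (n, Q, bad_query K) \<longleftrightarrow>
      \<not> (\<exists>w. map enc_op w @ [enc End] \<in> lang (?load ?T) \<and> run w (\<lambda>_. 0) \<noteq> {})"
    unfolding containment_holds_def Q_def
    using containment_iff[OF form, where A = "{..<n}"] n by simp
  also have "\<dots> \<longleftrightarrow> exec (?load prog) (\<lambda>_. 0) = {}"
  proof -
    have "x @ [enc End] \<in> lang (?load ?T) \<longleftrightarrow> x \<in> lang (?load prog)" for x
      unfolding lang_load by auto
    then show ?thesis unfolding exec_def by blast
  qed
  also have "exec (?load prog) (\<lambda>_. 0) = exec R' s"
    by (simp add: exec_load exec_prog s_def fun_upd_twist)
  finally show False using halts by blast
qed

text \<open>Restricted inputs keep their codes, so a decider for all inputs also decides the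
  restricted problem.\<close>

theorem theorem5p2:
  "\<not> decidable_on containment_inputs input_code containment_holds \<and>
   \<not> decidable_on {(n, Q1, Q2) \<in> containment_inputs. crpq_fin Q2} input_code containment_holds"
proof -
  have "decidable_on {(n, Q1, Q2) \<in> containment_inputs. crpq_fin Q2} input_code containment_holds"
    if "decidable_on containment_inputs input_code containment_holds"
    using that unfolding decidable_on_def by blast
  then show ?thesis using crpq_fin_containment_undecidable by blast
qed

end
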